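(* Let $\alpha,\beta>0$ with $\beta<2\alpha-1$, let $n,d,m\in\mathbb{N}$, and let $G$ be a graph with property $P_\alpha(n,d)$. Let $S\subseteq V(G)$ be non-empty such that $|N_G(x)\cap S|\le\beta\cdot d_G(x)$ for every $x\in V(G)$. Then there is an algorithm which wins the $(G,S,dn,m,d)$-forest building game after performing a number of operations polynomial in $m+|V(G)|$.
   Context: For a graph $G=(V,E)$, $\partial_G(x)$ is the set of edges incident with $x$, and for $X\subseteq V$, $N_G(X)=\big(\bigcup_{x\in X}N_G(x)\big)\setminus X$. $G$ has property $P_\alpha(n,d)$ if for every $X\subseteq V$ with $|X|\le n$ and every $F\subseteq E$ with $|F\cap\partial_G(x)|\le\alpha\cdot d_G(x)$ for every $x\in X$, we have $|N_{G-F}(X)|\ge 2d|X|$. For a graph $G$, $S\subseteq V(G)$ and $N,m,d\in\mathbb{N}$, the $(G,S,N,m,d)$-forest building game is the following online game. At each step there is a forest $T\subseteq G$ (initially $T=(S,\emptyset)$) with fewer than $N$ edges; the adversary requests a vertex $v\in V(T)$ with $d_T(v)<d$, and we must choose a neighbor of $v$ in $V(G)\setminus V(T)$, extending $T$ by a new leaf. After every step the adversary may successively remove any number of vertices of degree $1$ in $T$, none of which may lie in $S$, but may perform such removals at most $m$ times in total. We win if at some point $T$ has $N$ edges.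
   Formalization: If the adversary has no vertex of degree less than d to request, the algorithm is taken to win even with fewer than dn edges; this happens only for d = 1, |S| < n, where reaching dn edges is impossible. *)

theory Defs
  imports Complex_Main "HOL-Computational_Algebra.Polynomial"
begin

section \<open>Graphs\<close>

type_synonym 'a graph = "'a set \<times> 'a set set"

abbreviation verts :: "'a graph \<Rightarrow> 'a set" where "verts G \<equiv> fst G"
abbreviation edges :: "'a graph \<Rightarrow> 'a set set" where "edges G \<equiv> snd G"

definition simple_graph :: "'a graph \<Rightarrow> bool" where
  "simple_graph G \<longleftrightarrow> finite (verts G) \<and>
     (\<forall>e\<in>edges G. \<exists>x\<in>verts G. \<exists>y\<in>verts G. x \<noteq> y \<and> e = {x, y})"

definition incident :: "'a graph \<Rightarrow> 'a \<Rightarrow> 'a set set" where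
  "incident G x = {e \<in> edges G. x \<in> e}"

definition deg :: "'a graph \<Rightarrow> 'a \<Rightarrow> nat" where
  "deg G x = card (incident G x)"

definition nbrs :: "'a graph \<Rightarrow> 'a \<Rightarrow> 'a set" where
  "nbrs G x = {y. {x, y} \<in> edges G}"

definition nbrs_of_set :: "'a graph \<Rightarrow> 'a set \<Rightarrow> 'a set" where
  "nbrs_of_set G X = (\<Union>x\<in>X. nbrs G x) - X"

definition delete_edges :: "'a graph \<Rightarrow> 'a set set \<Rightarrow> 'a graph" where
  "delete_edges G F = (verts G, edges G - F)"

definition delete_vertex :: "'a graph \<Rightarrow> 'a \<Rightarrow> 'a graph" where
  "delete_vertex G x = (verts G - {x}, edges G - incident G x)"

definition add_leaf :: "'a graph \<Rightarrow> 'a \<Rightarrow> 'a \<Rightarrow> 'a graph" where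
  "add_leaf T v u = (insert u (verts T), insert {v, u} (edges T))"

definition property_P :: "real \<Rightarrow> nat \<Rightarrow> nat \<Rightarrow> 'a graph \<Rightarrow> bool" where
  "property_P \<alpha> n d G \<longleftrightarrow>
     (\<forall>X F. X \<subseteq> verts G \<longrightarrow> card X \<le> n \<longrightarrow> F \<subseteq> edges G \<longrightarrow>
        (\<forall>x\<in>X. real (card (F \<inter> incident G x)) \<le> \<alpha> * real (deg G x)) \<longrightarrow>
        card (nbrs_of_set (delete_edges G F) X) \<ge> 2 * d * card X)"


section \<open>Programs and their running time\<close>

text \<open>
  Algorithms are programs of a random access machine whose memory consists of named
  two-dimensional arrays of natural numbers; a scalar variable is the entry (0, 0) of its array.
  Each node of an expression and each executed command counts as one operation. There is
  deliberately no multiplication (and no other operation that more than doubles the largest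
  number in use), so that counting operations at unit cost agrees up to polynomials with Turing
  machine time.
\<close>

type_synonym mem = "string \<Rightarrow> nat \<Rightarrow> nat \<Rightarrow> nat"

datatype exp =
    Lit nat
  | Read string exp exp
  | Add exp exp
  | Sub exp exp
  | Less exp exp
  | Equal exp exp

fun eval_exp :: "exp \<Rightarrow> mem \<Rightarrow> nat" where
  "eval_exp (Lit k) s = k"
| "eval_exp (Read a e1 e2) s = s a (eval_exp e1 s) (eval_exp e2 s)"
| "eval_exp (Add e1 e2) s = eval_exp e1 s + eval_exp e2 s"
| "eval_exp (Sub e1 e2) s = eval_exp e1 s - eval_exp e2 s"
| "eval_exp (Less e1 e2) s = (if eval_exp e1 s < eval_exp e2 s then 1 else 0)"
| "eval_exp (Equal e1 e2) s = (if eval_exp e1 s = eval_exp e2 s then 1 else 0)"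

fun cost_exp :: "exp \<Rightarrow> nat" where
  "cost_exp (Lit k) = 1"
| "cost_exp (Read a e1 e2) = 1 + cost_exp e1 + cost_exp e2"
| "cost_exp (Add e1 e2) = 1 + cost_exp e1 + cost_exp e2"
| "cost_exp (Sub e1 e2) = 1 + cost_exp e1 + cost_exp e2"
| "cost_exp (Less e1 e2) = 1 + cost_exp e1 + cost_exp e2"
| "cost_exp (Equal e1 e2) = 1 + cost_exp e1 + cost_exp e2"

definition store :: "string \<Rightarrow> nat \<Rightarrow> nat \<Rightarrow> nat \<Rightarrow> mem \<Rightarrow> mem" where
  "store a i j k s = s(a := (s a)(i := (s a i)(j := k)))"

datatype cmd =
    Skip
  | Assign string exp exp exp
  | Seq cmd cmd
  | Cond exp cmd cmd
  | While exp cmd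

text \<open>\<open>exec c s t s'\<close>: started in memory \<open>s\<close>, the command \<open>c\<close> terminates in memory \<open>s'\<close> after
  exactly \<open>t\<close> operations.\<close>

inductive exec :: "cmd \<Rightarrow> mem \<Rightarrow> nat \<Rightarrow> mem \<Rightarrow> bool" where
  Skip: "exec Skip s 1 s"
| Assign: "exec (Assign a e1 e2 e) s (1 + cost_exp e1 + cost_exp e2 + cost_exp e)
     (store a (eval_exp e1 s) (eval_exp e2 s) (eval_exp e s) s)"
| Seq: "exec c1 s t1 s' \<Longrightarrow> exec c2 s' t2 s'' \<Longrightarrow> exec (Seq c1 c2) s (1 + t1 + t2) s''"
| CondTrue: "eval_exp b s \<noteq> 0 \<Longrightarrow> exec c1 s t s' \<Longrightarrow>
     exec (Cond b c1 c2) s (1 + cost_exp b + t) s'"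
| CondFalse: "eval_exp b s = 0 \<Longrightarrow> exec c2 s t s' \<Longrightarrow>
     exec (Cond b c1 c2) s (1 + cost_exp b + t) s'"
| WhileFalse: "eval_exp b s = 0 \<Longrightarrow> exec (While b c) s (1 + cost_exp b) s"
| WhileTrue: "eval_exp b s \<noteq> 0 \<Longrightarrow> exec c s t1 s' \<Longrightarrow> exec (While b c) s' t2 s'' \<Longrightarrow>
     exec (While b c) s (1 + cost_exp b + t1 + t2) s''"

lemma exec_deterministic:
  "exec c s t s' \<Longrightarrow> exec c s t' s'' \<Longrightarrow> t' = t \<and> s'' = s'"
proof (induction arbitrary: t' s'' rule: exec.induct)
  case (Seq c1 s t1 s1 c2 t2 s2)
  from Seq.prems show ?case by cases (use Seq.IH in blast)
next
  case (WhileTrue b s c t1 s1 t2 s2)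
  from WhileTrue.prems show ?case by cases (use WhileTrue.hyps WhileTrue.IH in blast)+
next
  case (CondTrue b s c1 t s' c2)
  from CondTrue.prems show ?case by cases (use CondTrue.hyps CondTrue.IH in blast)+
next
  case (CondFalse b s c2 t s' c1)
  from CondFalse.prems show ?case by cases (use CondFalse.hyps CondFalse.IH in blast)+
qed (erule exec.cases; simp)+


section \<open>The forest building game played by an algorithm\<close>

text \<open>
  An online algorithm consists of one program preprocessing the input and two programs that are
  called whenever the adversary requests a vertex (which must be answered) or removes a vertex.
  The memory persists between the calls.
\<close>

record algorithm =
  on_start :: cmd
  on_request :: cmd
  on_removal :: cmd

text \<open>
  The input is the data of the game: the graph as an adjacency matrix, the set \<open>S\<close> and the numbers
  \<open>N\<close>, \<open>m\<close>, \<open>d\<close>. The machine sees vertices through a numbering \<open>\<nu>\<close> of \<open>V(G)\<close> by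
  \<open>0, \<dots>, |V(G)| - 1\<close>.
\<close>

definition input :: "'a graph \<Rightarrow> 'a set \<Rightarrow> nat \<Rightarrow> nat \<Rightarrow> nat \<Rightarrow> ('a \<Rightarrow> nat) \<Rightarrow> mem" where
  "input G S N m d \<nu> = (\<lambda>a i j.
     if a = ''adj'' then (if \<exists>x y. {x, y} \<in> edges G \<and> \<nu> x = i \<and> \<nu> y = j then 1 else 0)
     else if a = ''S'' then (if i \<in> \<nu> ` S \<and> j = 0 then 1 else 0)
     else if i = 0 \<and> j = 0 then
       (if a = ''order'' then card (verts G)
        else if a = ''N'' then N
        else if a = ''m'' then m
        else if a = ''d'' then d
        else 0)
     else 0)"

text \<open>\<open>removals S T ws T'\<close>: the vertices \<open>ws\<close> may be removed successively from \<open>T\<close>, resulting in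
  \<open>T'\<close>.\<close>

inductive removals :: "'a set \<Rightarrow> 'a graph \<Rightarrow> 'a list \<Rightarrow> 'a graph \<Rightarrow> bool" for S where
  Nil: "removals S T [] T"
| Cons: "w \<in> verts T - S \<Longrightarrow> deg T w = 1 \<Longrightarrow> removals S (delete_vertex T w) ws T' \<Longrightarrow>
     removals S T (w # ws) T'"

inductive exec_removals ::
    "algorithm \<Rightarrow> ('a \<Rightarrow> nat) \<Rightarrow> 'a list \<Rightarrow> mem \<Rightarrow> nat \<Rightarrow> mem \<Rightarrow> bool" for A \<nu> where
  Nil: "exec_removals A \<nu> [] s 0 s"
| Cons: "exec (on_removal A) (store ''removed'' 0 0 (\<nu> w) s) t1 s' \<Longrightarrow>
     exec_removals A \<nu> ws s' t2 s'' \<Longrightarrow> exec_removals A \<nu> (w # ws) s (t1 + t2) s''"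

text \<open>
  \<open>wins_from G S N d \<nu> A T r s t\<close>: in the position where the current forest is \<open>T\<close>, the adversary
  may still make removals \<open>r\<close> times and the memory is \<open>s\<close>, the algorithm \<open>A\<close> reaches a forest with
  \<open>N\<close> edges against every behaviour of the adversary, using at most \<open>t\<close> further operations in total.
  As this is a least fixed point, no play can go on forever.

  Removing any positive number of vertices between two steps uses up one of the \<open>r\<close> removals. An
  adversary having no vertex to request loses; as long as \<open>T\<close> has fewer than \<open>N = dn\<close> edges, this
  can only happen for \<open>d = 1\<close>. That \<open>T\<close> is a forest contained in \<open>G\<close> is automatic, since it arises
  from \<open>(S, {})\<close> by adding and removing leaves.
\<close>

inductive wins_from ::
    "'a graph \<Rightarrow> 'a set \<Rightarrow> nat \<Rightarrow> nat \<Rightarrow> ('a \<Rightarrow> nat) \<Rightarrow> algorithm \<Rightarrow>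
     'a graph \<Rightarrow> nat \<Rightarrow> mem \<Rightarrow> nat \<Rightarrow> bool"
  for G S N d \<nu> A where
  won: "card (edges T) = N \<Longrightarrow> wins_from G S N d \<nu> A T r s t"
| step: "card (edges T) < N \<Longrightarrow>
    (\<And>v. v \<in> verts T \<Longrightarrow> deg T v < d \<Longrightarrow>
       \<exists>t1 s' u. exec (on_request A) (store ''request'' 0 0 (\<nu> v) s) t1 s' \<and> t1 \<le> t \<and>
         u \<in> nbrs G v \<inter> (verts G - verts T) \<and> s' ''answer'' 0 0 = \<nu> u \<and>
         (card (edges (add_leaf T v u)) = N \<or>
          (\<forall>ws T'. removals S (add_leaf T v u) ws T' \<longrightarrow> (ws = [] \<or> 0 < r) \<longrightarrow>
            (\<exists>t2 s''. exec_removals A \<nu> ws s' t2 s'' \<and> t1 + t2 \<le> t \<and>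
               wins_from G S N d \<nu> A T' (if ws = [] then r else r - 1) s'' (t - (t1 + t2)))))) \<Longrightarrow>
    wins_from G S N d \<nu> A T r s t"

definition wins_game ::
    "algorithm \<Rightarrow> 'a graph \<Rightarrow> 'a set \<Rightarrow> nat \<Rightarrow> nat \<Rightarrow> nat \<Rightarrow> ('a \<Rightarrow> nat) \<Rightarrow> nat \<Rightarrow> bool" where
  "wins_game A G S N m d \<nu> t \<longleftrightarrow>
     (\<exists>t0 s. exec (on_start A) (input G S N m d \<nu>) t0 s \<and> t0 \<le> t \<and>
        wins_from G S N d \<nu> A (S, {}) m s (t - t0))"

end

theory Submission
  imports Defs
begin

text \<open>
  The parameters \<open>\<alpha>\<close> and \<open>\<beta>\<close> need not be known to the player. Let \<open>U\<close> be the set of vertices outside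
  \<open>S\<close> that are in the forest or reserved, and call a vertex critical if it has more neighbours in \<open>U\<close>
  than neighbours outside \<open>U\<close> and \<open>S\<close>. Since at most a \<open>\<beta>\<close>-fraction of its neighbours lies in \<open>S\<close>, less
  than half of \<open>1 + \<beta> < 2\<alpha>\<close> times its degree leads out of \<open>U\<close> if it is critical, and at most that much
  into \<open>U \<union> S\<close> if it is not. Hence critical sets expand into \<open>U\<close> and non-critical sets into the free
  vertices.

  The player keeps the following condition on the forest \<open>T\<close>: every set \<open>Z\<close> of at most \<open>n\<close> vertices has
  at least \<open>d|Z|\<close> vertices that are children of \<open>Z\<close> in \<open>T\<close> or neighbours of \<open>Z\<close> outside \<open>T\<close>. Removing a
  leaf preserves it. To answer a request, the player computes from scratch a set \<open>X\<close> of vertices, each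
  owning exactly \<open>d\<close> vertices (its children and some reserved neighbours), such that no vertex outside
  \<open>X\<close> is critical. It starts with \<open>X = {}\<close>, adds critical vertices to \<open>X\<close> and lets the members of \<open>X\<close>
  that lack vertices take free ones or steal reserved ones, in a push-relabel fashion. Everything in
  \<open>X\<close> is critical, so the expansion into \<open>U\<close> gives \<open>|X| < n\<close>; then the condition, which is Hall's
  condition for \<open>X\<close>, bounds the levels and the process stops. A requested vertex in \<open>X\<close> gets one of its
  reserved vertices, any other one a free neighbour. The condition survives: for a set \<open>Z\<close>, count the
  vertices owned by \<open>Z \<inter> X\<close> and the free neighbours of \<open>Z - X\<close>, which number at least \<open>2d|Z - X|\<close>, so
  that one of them can be spared for the answer.
\<close>

section \<open>Running times of programs\<close>

abbreviation scalar :: "string \<Rightarrow> exp" where "scalar a \<equiv> Read a (Lit 0) (Lit 0)"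
abbreviation entry :: "string \<Rightarrow> exp \<Rightarrow> exp" where "entry a e \<equiv> Read a e (Lit 0)"
abbreviation set_scalar :: "string \<Rightarrow> exp \<Rightarrow> cmd" where "set_scalar a e \<equiv> Assign a (Lit 0) (Lit 0) e"
abbreviation set_entry :: "string \<Rightarrow> exp \<Rightarrow> exp \<Rightarrow> cmd" where
  "set_entry a i e \<equiv> Assign a i (Lit 0) e"

text \<open>Total correctness with a cost bound. An upper bound instead of the exact cost lets
  executions through different branches share one estimate.\<close>

definition runs :: "cmd \<Rightarrow> mem \<Rightarrow> nat \<Rightarrow> (mem \<Rightarrow> bool) \<Rightarrow> bool" where
  "runs c s t Q \<longleftrightarrow> (\<exists>t' s'. exec c s t' s' \<and> t' \<le> t \<and> Q s')"

lemma runs_mono: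
  "runs c s t Q \<Longrightarrow> t \<le> t' \<Longrightarrow> (\<And>s'. Q s' \<Longrightarrow> Q' s') \<Longrightarrow> runs c s t' Q'"
  unfolding runs_def by (meson le_trans)

lemma runs_Seq:
  assumes "runs c1 s t1 P" "\<And>s'. P s' \<Longrightarrow> runs c2 s' t2 Q"
  shows "runs (Seq c1 c2) s (1 + t1 + t2) Q"
proof -
  obtain u1 s1 where 1: "exec c1 s u1 s1" "u1 \<le> t1" "P s1" using assms(1) by (auto simp: runs_def)
  obtain u2 s2 where 2: "exec c2 s1 u2 s2" "u2 \<le> t2" "Q s2"
    using assms(2)[OF 1(3)] by (auto simp: runs_def)
  have "exec (Seq c1 c2) s (1 + u1 + u2) s2" by (rule exec.Seq[OF 1(1) 2(1)])
  then show ?thesis using 1 2 unfolding runs_def by (meson add_le_mono order_refl)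
qed

text \<open>Loop-free commands can be run by rewriting: \<open>effect\<close> is the final memory,
  and \<open>max_cost\<close> adds up both branches of a conditional so as not to depend on the
  memory.\<close>

fun straight :: "cmd \<Rightarrow> bool" where
  "straight Skip = True"
| "straight (Assign a e1 e2 e) = True"
| "straight (Seq c1 c2) = (straight c1 \<and> straight c2)"
| "straight (Cond b c1 c2) = (straight c1 \<and> straight c2)"
| "straight (While b c) = False"

fun effect :: "cmd \<Rightarrow> mem \<Rightarrow> mem" where
  "effect Skip s = s"
| "effect (Assign a e1 e2 e) s = store a (eval_exp e1 s) (eval_exp e2 s) (eval_exp e s) s"
| "effect (Seq c1 c2) s = effect c2 (effect c1 s)"
| "effect (Cond b c1 c2) s = (if eval_exp b s \<noteq> 0 then effect c1 s else effect c2 s)"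
| "effect (While b c) s = s"

fun max_cost :: "cmd \<Rightarrow> nat" where
  "max_cost Skip = 1"
| "max_cost (Assign a e1 e2 e) = 1 + cost_exp e1 + cost_exp e2 + cost_exp e"
| "max_cost (Seq c1 c2) = 1 + max_cost c1 + max_cost c2"
| "max_cost (Cond b c1 c2) = 1 + cost_exp b + max_cost c1 + max_cost c2"
| "max_cost (While b c) = 0"

lemma straight_exec: "straight c \<Longrightarrow> \<exists>t. exec c s t (effect c s) \<and> t \<le> max_cost c"
proof (induction c arbitrary: s)
  case Skip
  show ?case using exec.Skip by force
next
  case (Assign a e1 e2 e)
  show ?case using exec.Assign[of a e1 e2 e s] by auto
next
  case (Seq c1 c2)
  obtain t1 where 1: "exec c1 s t1 (effect c1 s)" "t1 \<le> max_cost c1" using Seq by fastforce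
  obtain t2 where 2: "exec c2 (effect c1 s) t2 (effect c2 (effect c1 s))" "t2 \<le> max_cost c2"
    using Seq by fastforce
  show ?case using exec.Seq[OF 1(1) 2(1)] 1(2) 2(2) by (intro exI[of _ "1 + t1 + t2"]) simp
next
  case (Cond b c1 c2)
  obtain t1 where 1: "exec c1 s t1 (effect c1 s)" "t1 \<le> max_cost c1" using Cond by fastforce
  obtain t2 where 2: "exec c2 s t2 (effect c2 s)" "t2 \<le> max_cost c2" using Cond by fastforce
  show ?case
  proof (cases "eval_exp b s = 0")
    case True
    show ?thesis using exec.CondFalse[OF True 2(1), of c1] True 2(2)
      by (intro exI[of _ "1 + cost_exp b + t2"]) simp
  next
    case False
    show ?thesis using exec.CondTrue[OF False 1(1), of c2] False 1(2)
      by (intro exI[of _ "1 + cost_exp b + t1"]) simp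
  qed
qed simp

lemma runs_straight: "straight c \<Longrightarrow> max_cost c \<le> t \<Longrightarrow> Q (effect c s) \<Longrightarrow> runs c s t Q"
  using straight_exec[of c s] unfolding runs_def by (meson le_trans)

text \<open>The variant \<open>f\<close> drops in every iteration, so the body runs at most
  \<open>f s\<close> times and the guard is evaluated at most \<open>Suc (f s)\<close>
  times.\<close>

lemma runs_While:
  assumes "I s"
    and body: "\<And>s. I s \<Longrightarrow> eval_exp b s \<noteq> 0 \<Longrightarrow> runs c s t (\<lambda>s'. I s' \<and> f s' < f s)"
    and exit: "\<And>s. I s \<Longrightarrow> eval_exp b s = 0 \<Longrightarrow> Q s"
  shows "runs (While b c) s (Suc (f s) * (1 + cost_exp b + t)) Q"
  using assms(1)
proof (induction "f s" arbitrary: s rule: less_induct)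
  case less
  show ?case
  proof (cases "eval_exp b s = 0")
    case True
    then show ?thesis using exec.WhileFalse[OF True, of c] exit[OF less.prems True]
      unfolding runs_def by (intro exI[of _ "1 + cost_exp b"] exI[of _ s]) simp
  next
    case False
    obtain t1 s1 where 1: "exec c s t1 s1" "t1 \<le> t" "I s1" "f s1 < f s"
      using body[OF less.prems False] by (auto simp: runs_def)
    obtain t2 s2 where 2: "exec (While b c) s1 t2 s2"
        "t2 \<le> Suc (f s1) * (1 + cost_exp b + t)" "Q s2"
      using less.hyps[OF 1(4,3)] by (auto simp: runs_def)
    have "Suc (f s1) * (1 + cost_exp b + t) \<le> f s * (1 + cost_exp b + t)"
      using 1(4) by (intro mult_right_mono) auto
    then have "1 + cost_exp b + t1 + t2 \<le> Suc (f s) * (1 + cost_exp b + t)"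
      using 1(2) 2(2) by simp
    then show ?thesis
      using exec.WhileTrue[OF False 1(1) 2(1)] 2(3) unfolding runs_def by blast
  qed
qed

text \<open>Decrementing before the body makes the body see every index below \<open>order\<close>,
  in descending order, and lets the variable itself serve as the guard.\<close>

definition For :: "string \<Rightarrow> cmd \<Rightarrow> cmd" where
  "For x c = Seq (set_scalar x (scalar ''order''))
     (While (scalar x) (Seq (set_scalar x (Sub (scalar x) (Lit 1))) c))"

lemma store_apply [simp]:
  "store a i j k s b = (if b = a then (s a)(i := (s a i)(j := k)) else s b)"
  by (simp add: store_def)

text \<open>\<open>I k\<close> stands for the state in which the indices from \<open>k\<close>
  upwards have been treated. The 7 pays for the initial assignment and its sequencing, the 13 for
  guard, decrement and sequencing in each iteration.\<close>

lemma runs_For: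
  assumes order: "s ''order'' 0 0 = m"
    and init: "I m (store x 0 0 m s)"
    and body: "\<And>k s. k < m \<Longrightarrow> I (Suc k) s \<Longrightarrow> s x 0 0 = Suc k \<Longrightarrow>
      runs c (store x 0 0 k s) t (\<lambda>s'. I k s' \<and> s' x 0 0 = k)"
    and exit: "\<And>s'. I 0 s' \<Longrightarrow> Q s'"
    and T: "7 + Suc m * (13 + t) \<le> T"
  shows "runs (For x c) s T Q"
proof -
  let ?inc = "set_scalar x (Sub (scalar x) (Lit 1))"
  let ?J = "\<lambda>s. I (s x 0 0) s \<and> s x 0 0 \<le> m"
  have step: "runs (Seq ?inc c) s (1 + 8 + t) (\<lambda>s'. ?J s' \<and> s' x 0 0 < s x 0 0)"
    if J: "?J s" and nz: "eval_exp (scalar x) s \<noteq> 0" for s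
  proof -
    obtain k where k: "s x 0 0 = Suc k" using nz by (cases "s x 0 0") auto
    have "runs ?inc s 8 (\<lambda>s'. s' = store x 0 0 k s)"
      by (rule runs_straight) (auto simp: k)
    then show ?thesis
    proof (rule runs_Seq)
      fix s' assume "s' = store x 0 0 k s"
      then show "runs c s' t (\<lambda>s'. ?J s' \<and> s' x 0 0 < s x 0 0)"
        using body[of k s] J k by (auto elim!: runs_mono)
    qed
  qed
  have "runs (For x c) s (1 + 6 + Suc m * (1 + 3 + (1 + 8 + t))) Q"
    unfolding For_def
  proof (rule runs_Seq)
    show "runs (set_scalar x (scalar ''order'')) s 6 (\<lambda>s'. s' = store x 0 0 m s)"
      by (rule runs_straight) (auto simp: order)
    fix s' assume s': "s' = store x 0 0 m s"
    have "runs (While (scalar x) (Seq ?inc c)) s'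
        (Suc (s' x 0 0) * (1 + cost_exp (scalar x) + (1 + 8 + t))) Q"
      by (rule runs_While[where I = ?J and f = "\<lambda>s. s x 0 0", OF _ step]) (use init exit s' in auto)
    then show "runs (While (scalar x) (Seq ?inc c)) s' (Suc m * (1 + 3 + (1 + 8 + t))) Q"
      by (simp add: s')
  qed
  then show ?thesis using T by (elim runs_mono) auto
qed

section \<open>Reservations in expanding graphs\<close>

text \<open>The expansion property on numbered vertices, with \<open>R\<close> in the role of the
  set S. The premise on \<open>U\<close> says that cutting off the neighbours in \<open>U\<close>
  costs at most a fraction (1 + \<beta>) / 2 < \<alpha> of each degree, but mentions neither
  constant.\<close>

locale expander =
  fixes nv n d :: nat and nb :: "nat \<Rightarrow> nat set" and R :: "nat set"
  assumes nb_subset: "nb x \<subseteq> {..<nv}"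
    and n_pos: "0 < n" and d_pos: "0 < d"
    and expansion: "\<And>Z U. Z \<subseteq> {..<nv} \<Longrightarrow> card Z \<le> n \<Longrightarrow>
      (\<And>z. z \<in> Z \<Longrightarrow> 2 * card (nb z \<inter> U) \<le> card (nb z) + card (nb z \<inter> R)) \<Longrightarrow>
      2 * d * card Z \<le> card (\<Union>(nb ` Z) - U)"
begin

lemma finite_nb [simp]: "finite (nb x)"
  using nb_subset finite_subset by blast

text \<open>\<open>par i\<close> is the successor of the parent of \<open>i\<close> in the forest, and \<open>0\<close> if \<open>i\<close> is a root or not in the
  forest.\<close>

definition hall :: "(nat \<Rightarrow> nat) \<Rightarrow> bool" where
  "hall par \<longleftrightarrow> (\<forall>Z\<subseteq>{..<nv}. card Z \<le> n \<longrightarrow>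
     d * card Z \<le> card (\<Union>(nb ` Z) - R - {i. par i \<noteq> 0}) + card {i. par i \<noteq> 0 \<and> par i - 1 \<in> Z})"

text \<open>For \<open>U = R\<close> the premise of \<open>expansion\<close> is trivial, and with an
  empty forest all neighbours outside \<open>R\<close> are free.\<close>

lemma hall_init: "hall (\<lambda>_. 0)"
  unfolding hall_def
proof (intro allI impI)
  fix Z assume Z: "Z \<subseteq> {..<nv}" "card Z \<le> n"
  have "2 * d * card Z \<le> card (\<Union>(nb ` Z) - R)"
    by (rule expansion[OF Z]) (simp add: card_mono)
  then show "d * card Z \<le> card (\<Union>(nb ` Z) - R - {i. (0::nat) \<noteq> 0}) + card {i. (0::nat) \<noteq> 0 \<and> 0 - 1 \<in> Z}"
    by simp
qed

text \<open>If \<open>w\<close> is lost as a child of \<open>Z\<close>, then its parent lies in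
  \<open>Z\<close> and \<open>w\<close> becomes a free neighbour of \<open>Z\<close>. So the union
  of the two counted sets does not shrink.\<close>

lemma hall_remove:
  assumes "hall par" and "finite {i. par i \<noteq> 0}" and w: "w \<in> nb (par w - 1)" "w \<notin> R"
    and leaf: "\<And>i. par i \<noteq> Suc w"
  shows "hall (par(w := 0))"
  unfolding hall_def
proof (intro allI impI)
  fix Z assume Z: "Z \<subseteq> {..<nv}" "card Z \<le> n"
  let ?N = "\<Union>(nb ` Z)"
  let ?A = "?N - R - {i. par i \<noteq> 0}" and ?B = "{i. par i \<noteq> 0 \<and> par i - 1 \<in> Z}"
  let ?A' = "?N - R - {i. (par(w := 0)) i \<noteq> 0}"
  let ?B' = "{i. (par(w := 0)) i \<noteq> 0 \<and> (par(w := 0)) i - 1 \<in> Z}"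
  have fin: "finite Z" using Z(1) finite_subset by blast
  have "?A \<union> ?B \<subseteq> ?A' \<union> ?B'" using w by auto
  moreover have "finite (?A' \<union> ?B')" using fin assms(2) by (auto elim: rev_finite_subset)
  ultimately have "card (?A \<union> ?B) \<le> card (?A' \<union> ?B')" by (rule card_mono[rotated])
  moreover have "card (?A \<union> ?B) = card ?A + card ?B"
    using fin by (intro card_Un_disjoint finite_subset[OF _ assms(2), of ?B]) auto
  moreover have "card (?A' \<union> ?B') \<le> card ?A' + card ?B'" by (rule card_Un_le)
  moreover have "d * card Z \<le> card ?A + card ?B"
    using assms(1) Z unfolding hall_def by blast
  ultimately show "d * card Z \<le> card ?A' + card ?B'" by linarith
qed

text \<open>Expansion with \<open>U = {}\<close> is limited by the number of vertices: if
  \<open>n\<close> exceeded \<open>nv\<close>, the set of all vertices could not expand, and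
  otherwise any \<open>n\<close> vertices give the bound. It keeps the length of the game
  polynomial.\<close>

lemma size_bound:
  assumes "0 < nv"
  shows "d * n \<le> nv"
proof -
  have *: "2 * d * card Z \<le> nv" if "Z \<subseteq> {..<nv}" "card Z \<le> n" for Z
  proof -
    have "2 * d * card Z \<le> card (\<Union>(nb ` Z) - {})" by (rule expansion[OF that]) simp
    also have "\<dots> \<le> card {..<nv}" using nb_subset by (intro card_mono) auto
    finally show ?thesis by simp
  qed
  have "n \<le> nv"
  proof (rule ccontr)
    assume "\<not> n \<le> nv"
    then have "2 * d * nv \<le> nv" using *[of "{..<nv}"] by simp
    then show False using assms d_pos by (cases d) auto
  qed
  then have "2 * d * n \<le> nv" using *[of "{..<n}"] by simp
  then show ?thesis by simp
qed

end

section \<open>Positions awaiting a request and the state of the push-relabel procedure\<close>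

locale position = expander +
  fixes par :: "nat \<Rightarrow> nat"
  assumes par: "par i \<noteq> 0 \<Longrightarrow> i < nv \<and> i \<notin> R \<and> par i \<le> nv"
    and children: "card {i. par i = Suc x} \<le> d"
    and hall: "hall par"
    and few_edges: "card {i. par i \<noteq> 0} < d * n"
begin

lemma finite_par: "finite {i. par i \<noteq> 0}"
  by (rule finite_subset[of _ "{..<nv}"]) (use par in auto)

text \<open>\<open>own\<close> extends \<open>par\<close> by the vertices reserved for later requests. Both store \<open>x + 1\<close>
  for \<open>x\<close>, and \<open>0\<close> stands for no owner. Accordingly the level of \<open>x\<close> is \<open>lev (x + 1)\<close>, which makes \<open>lev (own u)\<close> the level of
  the owner of \<open>u\<close>, or \<open>0\<close> if there is no owner.\<close>

definition owned :: "(nat \<Rightarrow> nat) \<Rightarrow> nat \<Rightarrow> nat set" where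
  "owned own x = {i. i < nv \<and> own i = Suc x}"

definition taken :: "(nat \<Rightarrow> nat) \<Rightarrow> nat set" where
  "taken own = {i. i < nv \<and> own i \<noteq> 0}"

definition critical :: "(nat \<Rightarrow> nat) \<Rightarrow> nat \<Rightarrow> bool" where
  "critical own x \<longleftrightarrow> card (nb x - R - taken own) < card (nb x \<inter> taken own)"

text \<open>The set \<open>X\<close> of the overview. Level 0 means not having joined it; since
  levels are never lowered, no vertex leaves it.\<close>

definition active :: "(nat \<Rightarrow> nat) \<Rightarrow> nat set" where
  "active lev = {x. x < nv \<and> lev (Suc x) > 0}"

text \<open>The fourth condition is the push-relabel invariant: no level exceeds by more than one the level of
  the owner of an available neighbour.\<close>

definition valid :: "(nat \<Rightarrow> nat) \<Rightarrow> (nat \<Rightarrow> nat) \<Rightarrow> bool" where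
  "valid lev own \<longleftrightarrow>
     (\<forall>i. par i \<noteq> 0 \<longrightarrow> own i = par i) \<and>
     (\<forall>i<nv. par i = 0 \<longrightarrow> own i \<noteq> 0 \<longrightarrow>
        i \<notin> R \<and> own i - 1 \<in> active lev \<and> i \<in> nb (own i - 1)) \<and>
     (\<forall>x<nv. card (owned own x) \<le> d) \<and>
     (\<forall>x<nv. \<forall>u\<in>nb x. u \<notin> R \<longrightarrow> par u = 0 \<longrightarrow> lev (Suc x) \<le> Suc (lev (own u))) \<and>
     (\<forall>x\<in>active lev. critical own x) \<and>
     card (active lev) < n \<and> lev 0 = 0 \<and> (\<forall>x<nv. lev (Suc x) \<le> Suc nv)"

text \<open>Raising a vertex increases a first summand, and stealing increases a second one, because
  the stolen vertex passes to an owner of higher level. As levels are bounded, this bounds the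
  number of moves.\<close>

definition potential :: "(nat \<Rightarrow> nat) \<Rightarrow> (nat \<Rightarrow> nat) \<Rightarrow> nat" where
  "potential lev own = (\<Sum>x<nv. lev (Suc x) + lev (own x))"

lemma finite_sets [simp]: "finite (owned own x)" "finite (taken own)" "finite (active lev)"
  by (auto simp: owned_def taken_def active_def)

lemma validD:
  assumes "valid lev own"
  shows "par i \<noteq> 0 \<Longrightarrow> own i = par i"
    and "i < nv \<Longrightarrow> par i = 0 \<Longrightarrow> own i \<noteq> 0 \<Longrightarrow>
        i \<notin> R \<and> own i - 1 \<in> active lev \<and> i \<in> nb (own i - 1)"
    and "x < nv \<Longrightarrow> card (owned own x) \<le> d"
    and "x < nv \<Longrightarrow> u \<in> nb x \<Longrightarrow> u \<notin> R \<Longrightarrow> par u = 0 \<Longrightarrow> lev (Suc x) \<le> Suc (lev (own u))"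
    and "x \<in> active lev \<Longrightarrow> critical own x"
    and "card (active lev) < n" and "lev 0 = 0" and "x < nv \<Longrightarrow> lev (Suc x) \<le> Suc nv"
  using assms unfolding valid_def by blast+

lemma taken_R:
  assumes v: "valid lev own"
  shows "taken own \<inter> R = {}"
proof -
  have "i \<notin> R" if "i \<in> taken own" for i
  proof (cases "par i = 0")
    case True
    then show ?thesis using that validD(2)[OF v] unfolding taken_def by blast
  next
    case False
    then show ?thesis using par by blast
  qed
  then show ?thesis by blast
qed

lemma own_le:
  assumes v: "valid lev own" and i: "i < nv"
  shows "own i \<le> nv"
proof (cases "par i = 0")
  case True
  then show ?thesis using validD(2)[OF v i] unfolding active_def by fastforce
next
  case False
  then show ?thesis using validD(1)[OF v] par[of i] by simp
qed

lemma lev_own_le: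
  assumes v: "valid lev own" and i: "i < nv"
  shows "lev (own i) \<le> Suc nv"
proof (cases "own i")
  case (Suc x)
  then show ?thesis using own_le[OF v i] validD(8)[OF v, of x] by simp
qed (use validD(7)[OF v] in simp)

lemma potential_le:
  assumes "valid lev own"
  shows "potential lev own \<le> nv * (2 * Suc nv)"
proof -
  have "potential lev own \<le> of_nat (card {..<nv}) * (2 * Suc nv)"
    unfolding potential_def
    by (rule sum_bounded_above)
      (use validD(8)[OF assms] lev_own_le[OF assms] in \<open>fastforce simp: add_mono\<close>)
  then show ?thesis by simp
qed

section \<open>Expansion of critical and non-critical sets\<close>

lemma card_split:
  assumes "taken own \<inter> R = {}"
  shows "card (nb x) = card (nb x \<inter> taken own) + card (nb x \<inter> R) + card (nb x - R - taken own)"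
    and "card (nb x \<inter> - taken own) = card (nb x \<inter> R) + card (nb x - R - taken own)"
    and "card (nb x \<inter> (taken own \<union> R)) = card (nb x \<inter> taken own) + card (nb x \<inter> R)"
proof -
  have "nb x \<inter> - taken own = (nb x \<inter> R) \<union> (nb x - R - taken own)" using assms by auto
  then show a: "card (nb x \<inter> - taken own) = card (nb x \<inter> R) + card (nb x - R - taken own)"
    by (simp only:) (rule card_Un_disjoint; auto)
  have "nb x = (nb x \<inter> taken own) \<union> (nb x \<inter> - taken own)" by auto
  then have "card (nb x) = card (nb x \<inter> taken own) + card (nb x \<inter> - taken own)"
    by (metis Diff_Int2 Diff_eq card_Int_Diff finite_nb)
  then show "card (nb x) = card (nb x \<inter> taken own) + card (nb x \<inter> R) + card (nb x - R - taken own)"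
    using a by simp
  have "nb x \<inter> (taken own \<union> R) = (nb x \<inter> taken own) \<union> (nb x \<inter> R)" by auto
  then show "card (nb x \<inter> (taken own \<union> R)) = card (nb x \<inter> taken own) + card (nb x \<inter> R)"
    by (simp only:) (rule card_Un_disjoint; use assms in auto)
qed

text \<open>Here \<open>U\<close> is the complement of \<open>taken own\<close>. If t, r, f count
  the neighbours that are taken, in \<open>R\<close> and free, the premise 2(r + f) \<le> (t + r +
  f) + r of \<open>expansion\<close> amounts to f \<le> t.\<close>

lemma expansion_into_taken:
  assumes "taken own \<inter> R = {}" "Z \<subseteq> {..<nv}" "card Z \<le> n" "\<And>z. z \<in> Z \<Longrightarrow> critical own z"
  shows "2 * d * card Z \<le> card (taken own)"
proof -
  have "2 * d * card Z \<le> card (\<Union>(nb ` Z) - - taken own)"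
    using assms(4) by (intro expansion assms(2,3)) (fastforce simp: critical_def card_split[OF assms(1)])
  also have "\<dots> \<le> card (taken own)" by (rule card_mono) auto
  finally show ?thesis .
qed

text \<open>Here \<open>U\<close> is \<open>taken own\<close> together with \<open>R\<close>; in the
  same notation, 2(t + r) \<le> (t + r + f) + r amounts to t \<le> f.\<close>

lemma expansion_into_free:
  assumes "taken own \<inter> R = {}" "Z \<subseteq> {..<nv}" "card Z \<le> n" "\<And>z. z \<in> Z \<Longrightarrow> \<not> critical own z"
  shows "2 * d * card Z \<le> card (\<Union>(nb ` Z) - (taken own \<union> R))"
  using assms(4)
  by (intro expansion assms(2,3)) (fastforce simp: critical_def card_split(1,3)[OF assms(1)] not_less)

text \<open>A taken vertex is in the forest or owned by an active vertex, and each of these owns at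
  most \<open>d\<close>.\<close>

lemma card_taken_le:
  assumes "valid lev own"
  shows "card (taken own) \<le> card {i. par i \<noteq> 0} + d * card (active lev)"
proof -
  have "taken own \<subseteq> {i. par i \<noteq> 0} \<union> \<Union>(owned own ` active lev)"
    using validD(2)[OF assms] by (fastforce simp: taken_def owned_def)
  then have "card (taken own) \<le> card ({i. par i \<noteq> 0} \<union> \<Union>(owned own ` active lev))"
    by (rule card_mono[rotated]) (intro finite_UnI finite_UN_I finite_par finite_sets)
  also have "\<dots> \<le> card {i. par i \<noteq> 0} + card (\<Union>(owned own ` active lev))" by (rule card_Un_le)
  also have "card (\<Union>(owned own ` active lev)) \<le> (\<Sum>x\<in>active lev. card (owned own x))"
    by (rule card_UN_le) simp
  also have "\<dots> \<le> of_nat (card (active lev)) * d"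
    by (rule sum_bounded_above) (use validD(3)[OF assms] in \<open>auto simp: active_def\<close>)
  finally show ?thesis by (simp add: mult.commute)
qed

text \<open>With k active vertices, the k + 1 critical ones including \<open>x\<close> expand into
  the taken vertices, of which there are fewer than dn + dk. Hence 2d(k + 1) < dn + dk, that is, k +
  2 < n.\<close>

lemma active_promote:
  assumes v: "valid lev own" and x: "x < nv" "x \<notin> active lev" "critical own x"
  shows "Suc (card (active lev)) < n"
proof -
  let ?k = "card (active lev)"
  have "2 * d * card (insert x (active lev)) \<le> card (taken own)"
    by (rule expansion_into_taken[OF taken_R[OF v]])
      (use v x validD(5,6)[OF v] in \<open>auto simp: active_def\<close>)
  also have "\<dots> < d * n + d * ?k" using card_taken_le[OF v] few_edges by linarith
  finally have "2 * d * Suc ?k < d * n + d * ?k" using x(2) by simp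
  then have "d * (?k + 2) < d * n" by (simp add: algebra_simps)
  then have "?k + 2 < n" by (rule mult_left_less_imp_less) simp
  then show ?thesis by simp
qed

text \<open>If no vertex has level \<open>g\<close>, then everything that the vertices above \<open>g\<close> could use is owned by
  themselves. They violate \<open>hall\<close> if one of them owns too little.\<close>

lemma level_bound:
  assumes v: "valid lev own" and x: "x < nv" "card (owned own x) < d" "lev (Suc x) > 0"
  shows "lev (Suc x) \<le> card (active lev)"
proof (rule ccontr)
  assume high: "\<not> lev (Suc x) \<le> card (active lev)"
  have xa: "x \<in> active lev" using x by (simp add: active_def)
  \<comment> \<open>Pigeonhole: the active vertices other than \<open>x\<close> miss one of the
    levels from 1 to \<open>card (active lev)\<close>. As \<open>x\<close> lies above that range, no
    vertex has the missed level \<open>g\<close>.\<close>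
  let ?L = "(\<lambda>y. lev (Suc y)) ` (active lev - {x})"
  have "card ?L \<le> card (active lev - {x})" by (rule card_image_le) simp
  also have "\<dots> < card {1..card (active lev)}" using xa card_Diff1_less[OF finite_sets(3) xa] by simp
  finally have "\<not> {1..card (active lev)} \<subseteq> ?L"
    using card_mono[of ?L "{1..card (active lev)}"] by (meson finite_Diff finite_imageI finite_sets(3) not_less)
  then obtain g where g: "1 \<le> g" "g \<le> card (active lev)" "g \<notin> ?L"
    by (meson atLeastAtMost_iff subsetI)
  have gap: "lev (Suc y) \<noteq> g" if "y < nv" for y
  proof (cases "y = x")
    case False
    show ?thesis
    proof
      assume "lev (Suc y) = g"
      then have "y \<in> active lev - {x}" using that g(1) False by (simp add: active_def)
      then show False using g(3) \<open>lev (Suc y) = g\<close> by blast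
    qed
  qed (use g high in simp)
  define Z where "Z = {y. y < nv \<and> lev (Suc y) > g}"
  have xZ: "x \<in> Z" using x g high by (auto simp: Z_def)
  have Za: "Z \<subseteq> active lev" by (auto simp: Z_def active_def)
  have ZV: "Z \<subseteq> {..<nv}" by (auto simp: Z_def)
  then have fin: "finite Z" using finite_subset by blast
  have cardZ: "card Z \<le> n"
    using validD(6)[OF v] card_mono[OF finite_sets(3) Za] by linarith
  let ?A = "\<Union>(nb ` Z) - R - {i. par i \<noteq> 0}" and ?B = "{i. par i \<noteq> 0 \<and> par i - 1 \<in> Z}"
  have "?A \<union> ?B \<subseteq> \<Union>(owned own ` Z)"
  proof
    fix u assume "u \<in> ?A \<union> ?B"
    then consider y where "y \<in> Z" "u \<in> nb y" "u \<notin> R" "par u = 0" | "par u \<noteq> 0" "par u - 1 \<in> Z"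
      by blast
    then show "u \<in> \<Union>(owned own ` Z)"
    proof cases
      case 1
      have u: "u < nv" using 1 nb_subset by auto
      \<comment> \<open>The push-relabel invariant puts the owner of \<open>u\<close> at level at
        least \<open>g\<close>. This is positive, so there is an owner, and as level
        \<open>g\<close> is empty the owner lies above it.\<close>
      have "g < lev (Suc y)" "y < nv" using 1 by (auto simp: Z_def)
      then have ge: "g \<le> lev (own u)" using validD(4)[OF v, of y u] 1 by linarith
      then obtain z where z: "own u = Suc z"
        using g(1) validD(7)[OF v] by (cases "own u") auto
      then have "z < nv" using own_le[OF v u] by simp
      then have "z \<in> Z" using gap[of z] ge z by (simp add: Z_def)
      then show ?thesis using u z by (auto simp: owned_def)
    next
      case 2
      then show ?thesis
        using par[of u] validD(1)[OF v, of u] by (intro UN_I[of "par u - 1"]) (simp_all add: owned_def)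
    qed
  qed
  then have "card (?A \<union> ?B) \<le> card (\<Union>(owned own ` Z))" by (rule card_mono[rotated]) (simp add: fin)
  also have "\<dots> \<le> (\<Sum>y\<in>Z. card (owned own y))" by (rule card_UN_le[OF fin])
  also have "\<dots> < (\<Sum>y\<in>Z. d)"
  proof (rule sum_strict_mono_ex1[OF fin])
    show "\<forall>y\<in>Z. card (owned own y) \<le> d" using validD(3)[OF v] by (simp add: Z_def)
    show "\<exists>y\<in>Z. card (owned own y) < d" using x xZ by blast
  qed
  finally have "card (?A \<union> ?B) < d * card Z" by (simp add: mult.commute)
  moreover have "card (?A \<union> ?B) = card ?A + card ?B"
    using fin by (intro card_Un_disjoint finite_subset[OF _ finite_par, of ?B]) auto
  moreover have "d * card Z \<le> card ?A + card ?B" using hall cardZ ZV unfolding hall_def by blast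
  ultimately show False by linarith
qed

section \<open>The initial state and the two moves\<close>

lemma valid_init:
  assumes own: "\<And>i. i < nv \<Longrightarrow> own i = par i" and lev: "\<And>x. x \<le> nv \<Longrightarrow> lev x = 0"
  shows "valid lev own"
proof -
  have "owned own x = {i. par i = Suc x}" for x using par own by (fastforce simp: owned_def)
  then have "card (owned own x) \<le> d" for x using children by simp
  moreover have "active lev = {}" using lev by (simp add: active_def)
  moreover have "own i = par i" if "par i \<noteq> 0" for i using own par[OF that] by simp
  ultimately show ?thesis using n_pos own lev by (simp add: valid_def)
qed

text \<open>The vertices that need action: critical ones still to join, and members that own too
  little. The action is stealing if possible and raising otherwise; at level 0 nothing can be
  stolen, so joining is always a raise.\<close>

definition raises :: "(nat \<Rightarrow> nat) \<Rightarrow> (nat \<Rightarrow> nat) \<Rightarrow> nat \<Rightarrow> bool" where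
  "raises lev own x \<longleftrightarrow>
     lev (Suc x) = 0 \<and> critical own x \<or> lev (Suc x) > 0 \<and> card (owned own x) < d"

text \<open>This covers unowned vertices too: for them \<open>lev (own u)\<close> is
  \<open>lev 0\<close>, which is 0 in a valid state.\<close>

definition stealable :: "(nat \<Rightarrow> nat) \<Rightarrow> (nat \<Rightarrow> nat) \<Rightarrow> nat \<Rightarrow> nat \<Rightarrow> bool" where
  "stealable lev own x u \<longleftrightarrow> u \<in> nb x \<and> u \<notin> R \<and> par u = 0 \<and> lev (own u) < lev (Suc x)"

text \<open>If nothing can be stolen, \<open>x\<close> is no higher than the owners of its available
  neighbours, so one more level respects the invariant. The level was at most \<open>nv\<close> by
  \<open>level_bound\<close>, and \<open>active_promote\<close> leaves room for a new
  member.\<close>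

lemma raise_step:
  assumes v: "valid lev own" and x: "x < nv" "raises lev own x"
    and no: "\<And>u. \<not> stealable lev own x u"
  defines "lev' \<equiv> lev(Suc x := Suc (lev (Suc x)))"
  shows "valid lev' own" "potential lev own < potential lev' own"
proof -
  have act: "active lev' = insert x (active lev)" using x by (auto simp: active_def lev'_def)
  have mono: "lev i \<le> lev' i" for i by (simp add: lev'_def)
  have crit: "critical own x"
    using x validD(5)[OF v] by (auto simp: raises_def active_def)
  have few: "card (insert x (active lev)) < n"
    using active_promote[OF v x(1) _ crit] validD(6)[OF v] by (cases "x \<in> active lev") (auto simp: insert_absorb)
  have low: "lev (Suc x) \<le> nv"
  proof (cases "lev (Suc x) = 0")
    case False
    then have "lev (Suc x) \<le> card (active lev)"
      using x by (intro level_bound[OF v]) (auto simp: raises_def)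
    also have "\<dots> \<le> card {..<nv}" by (rule card_mono) (auto simp: active_def)
    finally show ?thesis by simp
  qed simp
  have 4: "lev' (Suc y) \<le> Suc (lev' (own u))"
    if "y < nv" "u \<in> nb y" "u \<notin> R" "par u = 0" for y u
  proof (cases "y = x")
    case True
    then have "lev (Suc x) \<le> lev (own u)" using that no[of u] by (auto simp: stealable_def)
    also have "\<dots> \<le> lev' (own u)" by (rule mono)
    finally show ?thesis using True by (simp add: lev'_def)
  next
    case False
    then have "lev' (Suc y) = lev (Suc y)" by (simp add: lev'_def)
    also have "\<dots> \<le> Suc (lev (own u))" by (rule validD(4)[OF v that])
    finally show ?thesis using mono[of "own u"] by simp
  qed
  show "valid lev' own"
    unfolding valid_def act
    using validD(1,2,3,5,7,8)[OF v] 4 few low crit x by (auto simp: lev'_def)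
  show "potential lev own < potential lev' own"
    unfolding potential_def
    by (rule sum_strict_mono_ex1) (use x mono in \<open>auto simp: lev'_def intro!: add_mono bexI[of _ x]\<close>)
qed

text \<open>The new owner is higher, which only relaxes the push-relabel invariant, and
  \<open>taken\<close> only grows, so critical vertices stay critical. The previous owner may drop
  below \<open>d\<close> vertices; this is repaired by later moves.\<close>

lemma steal_step:
  assumes v: "valid lev own" and x: "x < nv" "raises lev own x" and u: "stealable lev own x u"
  defines "own' \<equiv> own(u := Suc x)"
  shows "valid lev own'" "potential lev own < potential lev own'"
proof -
  have xa: "x \<in> active lev" "card (owned own x) < d" and un: "u < nv"
    using x u nb_subset by (auto simp: raises_def stealable_def active_def)
  have mono: "lev (own i) \<le> lev (own' i)" for i using u by (simp add: own'_def stealable_def)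
  have "taken own \<subseteq> taken own'" by (auto simp: own'_def taken_def)
  then have crit: "critical own' y" if "critical own y" for y
    using that card_mono[of "nb y \<inter> taken own'" "nb y \<inter> taken own"]
      card_mono[of "nb y - R - taken own" "nb y - R - taken own'"]
    unfolding critical_def
    by (meson Diff_mono Int_mono finite_Diff finite_Int finite_nb le_less_trans less_le_trans order_refl)
  have 3: "card (owned own' y) \<le> d" if "y < nv" for y
  proof (cases "y = x")
    case True
    then have "owned own' y \<subseteq> insert u (owned own x)" by (auto simp: owned_def own'_def)
    then have "card (owned own' y) \<le> card (insert u (owned own x))" by (rule card_mono[rotated]) simp
    also have "\<dots> \<le> Suc (card (owned own x))" by (rule card_insert_le_m1) auto
    finally show ?thesis using xa by simp
  next
    case False
    then have "owned own' y \<subseteq> owned own y" by (auto simp: owned_def own'_def split: if_splits)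
    then show ?thesis using validD(3)[OF v that] card_mono[of "owned own y" "owned own' y"] by simp
  qed
  have 4: "lev (Suc y) \<le> Suc (lev (own' w))" if "y < nv" "w \<in> nb y" "w \<notin> R" "par w = 0" for y w
    using validD(4)[OF v that] mono[of w] by simp
  have 1: "own' i = par i" if "par i \<noteq> 0" for i
    using validD(1)[OF v that] u that by (auto simp: own'_def stealable_def)
  have 2: "i \<notin> R \<and> own' i - 1 \<in> active lev \<and> i \<in> nb (own' i - 1)"
    if "i < nv" "par i = 0" "own' i \<noteq> 0" for i
    using validD(2)[OF v that(1,2)] that xa u by (auto simp: own'_def stealable_def split: if_splits)
  show "valid lev own'"
    unfolding valid_def using 1 2 3 4 crit validD(5,6,7,8)[OF v] by blast
  show "potential lev own < potential lev own'"
    unfolding potential_def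
    by (rule sum_strict_mono_ex1)
      (use un mono u in \<open>auto simp: own'_def stealable_def intro!: bexI[of _ u]\<close>)
qed

section \<open>Replies and the preservation of Hall's condition\<close>

definition settled :: "(nat \<Rightarrow> nat) \<Rightarrow> (nat \<Rightarrow> nat) \<Rightarrow> bool" where
  "settled lev own \<longleftrightarrow> valid lev own \<and> (\<forall>x<nv. \<not> raises lev own x)"

text \<open>A member of \<open>X\<close> uses up one of its own reservations, any other vertex takes
  an unowned vertex, so that no reservation of a third vertex is spent.\<close>

definition reply :: "(nat \<Rightarrow> nat) \<Rightarrow> (nat \<Rightarrow> nat) \<Rightarrow> nat \<Rightarrow> nat \<Rightarrow> bool" where
  "reply lev own v u \<longleftrightarrow> u \<in> nb v \<and> u \<notin> R \<and> par u = 0 \<and>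
     own u = (if lev (Suc v) = 0 then 0 else Suc v)"

text \<open>An inactive \<open>v\<close> is not critical and hence expands into free vertices. An
  active one owns \<open>d\<close> vertices, and fewer than \<open>d\<close> of these are
  children.\<close>

lemma reply_exists:
  assumes st: "settled lev own" and v: "v < nv" "card {i. par i = Suc v} < d"
  shows "\<exists>u. reply lev own v u"
proof (cases "lev (Suc v) = 0")
  case True
  have val: "valid lev own" using st by (simp add: settled_def)
  have "\<not> critical own v" using st v True by (auto simp: settled_def raises_def)
  then have le: "2 * d * card {v} \<le> card (\<Union>(nb ` {v}) - (taken own \<union> R))"
    using v n_pos by (intro expansion_into_free[OF taken_R[OF val]]) auto
  have "\<Union>(nb ` {v}) - (taken own \<union> R) \<noteq> {}"
  proof
    assume "\<Union>(nb ` {v}) - (taken own \<union> R) = {}"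
    then show False using le d_pos by (simp only: card.empty) simp
  qed
  then obtain u where u: "u \<in> nb v" "u \<notin> taken own" "u \<notin> R" by auto
  then have "own u = 0" using nb_subset by (auto simp: taken_def)
  then have "par u = 0" using validD(1)[OF val, of u] by auto
  then show ?thesis using u True \<open>own u = 0\<close> by (auto simp: reply_def)
next
  case False
  have val: "valid lev own" using st by (simp add: settled_def)
  have "\<not> card (owned own v) < d" using st v False by (auto simp: settled_def raises_def)
  then have "\<not> owned own v \<subseteq> {i. par i = Suc v}"
    using v(2) card_mono[of "{i. par i = Suc v}" "owned own v"]
      finite_subset[OF _ finite_par, of "{i. par i = Suc v}"] by fastforce
  then obtain u where u: "u < nv" "own u = Suc v" "par u \<noteq> Suc v" by (auto simp: owned_def)
  then have "par u = 0" using validD(1)[OF val, of u] by auto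
  then show ?thesis using u False validD(2)[OF val, of u] by (auto simp: reply_def)
qed

text \<open>Members of \<open>X\<close> contribute the \<open>d\<close> vertices that each of them
  owns, pairwise disjointly; the others expand into free vertices with a surplus that absorbs the
  loss of \<open>u\<close>.\<close>

lemma hall_reply:
  assumes st: "settled lev own" and u: "reply lev own v u"
  shows "hall (par(u := Suc v))"
  unfolding hall_def
proof (intro allI impI)
  fix Z assume Z: "Z \<subseteq> {..<nv}" "card Z \<le> n"
  have val: "valid lev own" using st by (simp add: settled_def)
  have fin: "finite Z" using Z finite_subset by blast
  define X where "X = Z \<inter> active lev"
  define Y where "Y = Z - active lev"
  let ?p = "par(u := Suc v)"
  let ?A = "\<Union>(nb ` Z) - R - {i. ?p i \<noteq> 0}" and ?B = "{i. ?p i \<noteq> 0 \<and> ?p i - 1 \<in> Z}"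
  let ?C = "\<Union>(owned own ` X)" and ?D = "\<Union>(nb ` Y) - (taken own \<union> R)"
  have fin': "finite X" "finite Y" using fin by (auto simp: X_def Y_def)
  have finB: "finite ?B" by (rule finite_subset[of _ "insert u {i. par i \<noteq> 0}"]) (use finite_par in auto)
  have C: "card ?C = d * card X"
  proof -
    have "card (owned own x) = d" if "x \<in> X" for x
      using that st validD(3)[OF val, of x] by (fastforce simp: X_def active_def settled_def raises_def)
    moreover have "card ?C = (\<Sum>x\<in>X. card (owned own x))"
      by (rule card_UN_disjoint) (use fin' in \<open>auto simp: owned_def\<close>)
    ultimately show ?thesis by simp
  qed
  have D: "d * card Y \<le> card (?D - {u})"
  proof (cases "Y = {}")
    case False
    then have "card Y > 0" using fin' by auto
    have "2 * d * card Y \<le> card ?D"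
    proof (rule expansion_into_free[OF taken_R[OF val]])
      show "card Y \<le> n" using Z card_mono[OF fin, of Y] by (auto simp: Y_def)
      show "\<not> critical own z" if "z \<in> Y" for z
        using that Z st by (auto simp: Y_def active_def settled_def raises_def)
    qed (use Z in \<open>auto simp: Y_def\<close>)
    moreover have "card ?D \<le> Suc (card (?D - {u}))" by (simp add: card_Diff_singleton_if) linarith
    \<comment> \<open>Half of the expansion is spare, and it is at least 1, the amount lost with
      \<open>u\<close>.\<close>
    moreover have "d * card Y > 0" using d_pos \<open>card Y > 0\<close> by simp
    ultimately show ?thesis by linarith
  qed simp
  have "?C \<union> (?D - {u}) \<subseteq> ?A \<union> ?B"
  proof
    fix w assume "w \<in> ?C \<union> (?D - {u})"
    then consider "w \<in> ?C" | "w \<in> ?D" "w \<noteq> u" by blast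
    then show "w \<in> ?A \<union> ?B"
    proof cases
      case 1
      then obtain x where x: "x \<in> Z" "w < nv" "own w = Suc x" by (auto simp: X_def owned_def)
      show ?thesis
      proof (cases "w = u")
        case True
        \<comment> \<open>If \<open>u\<close> is owned at all, its owner is \<open>v\<close>. So
          \<open>x = v\<close> lies in \<open>Z\<close>, and \<open>u\<close> turns from a
          reservation into a child.\<close>
        then show ?thesis using u x by (auto simp: reply_def split: if_splits)
      next
        case False
        show ?thesis
        proof (cases "par w = 0")
          case True
          then show ?thesis using validD(2)[OF val, of w] x False by auto
        next
          case par: False
          then have "par w = Suc x" using validD(1)[OF val] x by metis
          then show ?thesis using x False by simp
        qed
      qed
    next
      case 2
      then obtain y where y: "y \<in> Z" "w \<in> nb y" "w \<notin> R" "w \<notin> taken own" by (auto simp: Y_def)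
      then have "own w = 0" using nb_subset by (auto simp: taken_def)
      then have "par w = 0" using validD(1)[OF val, of w] by auto
      then show ?thesis using y 2 by auto
    qed
  qed
  then have "card (?C \<union> (?D - {u})) \<le> card (?A \<union> ?B)"
    by (rule card_mono[rotated]) (use fin finB in auto)
  also have "\<dots> \<le> card ?A + card ?B" by (rule card_Un_le)
  finally have "card (?C \<union> (?D - {u})) \<le> card ?A + card ?B" .
  moreover have "card (?C \<union> (?D - {u})) = card ?C + card (?D - {u})"
    using fin' by (intro card_Un_disjoint) (auto simp: owned_def taken_def)
  moreover have "card Z = card X + card Y"
    using fin by (simp add: X_def Y_def card_Int_Diff)
  ultimately show "d * card Z \<le> card ?A + card ?B"
    using C D by (simp add: add_mult_distrib2)
qed

end

section \<open>The program\<close>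

abbreviation inc :: "string \<Rightarrow> cmd" where "inc a \<equiv> set_scalar a (Add (scalar a) (Lit 1))"
abbreviation lev_x :: exp where "lev_x \<equiv> entry ''lev'' (Add (scalar ''x'') (Lit 1))"

text \<open>Examines one \<open>u\<close> for the current \<open>x\<close>: it updates the counts
  that decide \<open>raises\<close> and records a stealable vertex. \<open>steal\<close> holds its
  successor, so that 0 can mean none.\<close>

definition scan :: cmd where
  "scan =
     Seq (Cond (Equal (entry ''own'' (scalar ''u'')) (Add (scalar ''x'') (Lit 1))) (inc ''owned'') Skip)
       (Cond (Read ''adj'' (scalar ''x'') (scalar ''u''))
         (Seq
           (Cond (entry ''own'' (scalar ''u'')) (inc ''taken'')
             (Cond (entry ''S'' (scalar ''u'')) Skip (inc ''free'')))
           (Cond (entry ''S'' (scalar ''u'')) Skip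
             (Cond (entry ''par'' (scalar ''u'')) Skip
               (Cond (Less (entry ''lev'' (entry ''own'' (scalar ''u''))) lev_x)
                 (set_scalar ''steal'' (Add (scalar ''u'') (Lit 1))) Skip))))
         Skip)"

definition inspect :: cmd where
  "inspect =
     Seq (Seq (set_scalar ''owned'' (Lit 0)) (Seq (set_scalar ''taken'' (Lit 0))
         (Seq (set_scalar ''free'' (Lit 0)) (set_scalar ''steal'' (Lit 0)))))
       (For ''u'' scan)"

definition improve :: cmd where
  "improve =
     Seq (set_scalar ''changed'' (Lit 1))
       (Cond (scalar ''steal'')
         (set_entry ''own'' (Sub (scalar ''steal'') (Lit 1)) (Add (scalar ''x'') (Lit 1)))
         (set_entry ''lev'' (Add (scalar ''x'') (Lit 1)) (Add lev_x (Lit 1))))"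

definition update :: cmd where
  "update =
     Cond lev_x
       (Cond (Less (scalar ''owned'') (scalar ''d'')) improve Skip)
       (Cond (Less (scalar ''free'') (scalar ''taken'')) improve Skip)"

text \<open>A sweep that changes nothing has found no vertex in need of action, so the state is then
  settled.\<close>

definition stabilize :: cmd where
  "stabilize =
     While (scalar ''changed'')
       (Seq (set_scalar ''changed'' (Lit 0)) (For ''x'' (Seq inspect update)))"

text \<open>All reservations are forgotten and only the forest is kept. The loop writes levels from
  index 1 on; index 0, standing for no owner, is cleared separately.\<close>

definition initialize :: cmd where
  "initialize =
     Seq (Seq (set_entry ''lev'' (Lit 0) (Lit 0)) (set_scalar ''changed'' (Lit 1)))
       (For ''u''
         (Seq (set_entry ''own'' (scalar ''u'') (entry ''par'' (scalar ''u'')))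
           (set_entry ''lev'' (Add (scalar ''u'') (Lit 1)) (Lit 0))))"

definition select :: cmd where
  "select =
     Seq (Cond (entry ''lev'' (Add (scalar ''request'') (Lit 1)))
         (set_scalar ''want'' (Add (scalar ''request'') (Lit 1))) (set_scalar ''want'' (Lit 0)))
       (For ''u''
         (Cond (Read ''adj'' (scalar ''request'') (scalar ''u''))
           (Cond (entry ''S'' (scalar ''u'')) Skip
             (Cond (entry ''par'' (scalar ''u'')) Skip
               (Cond (Equal (entry ''own'' (scalar ''u'')) (scalar ''want''))
                 (set_scalar ''answer'' (scalar ''u'')) Skip)))
           Skip))"

definition respond :: cmd where
  "respond =
     Seq initialize (Seq stabilize (Seq select
       (set_entry ''par'' (scalar ''answer'') (Add (scalar ''request'') (Lit 1)))))"

text \<open>Matches the descending loops: treating index \<open>k\<close> extends a count over the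
  indices above \<open>k\<close>.\<close>

lemma card_from:
  fixes k :: nat
  assumes "finite A"
  shows "card {i \<in> A. k \<le> i} = (if k \<in> A then 1 else 0) + card {i \<in> A. Suc k \<le> i}"
proof (cases "k \<in> A")
  case True
  then have "{i \<in> A. k \<le> i} = insert k {i \<in> A. Suc k \<le> i}" by auto
  then show ?thesis using True assms by simp
next
  case False
  then have "{i \<in> A. k \<le> i} = {i \<in> A. Suc k \<le> i}" using Suc_le_eq le_less by blast
  then show ?thesis using False by simp
qed

text \<open>The part of the memory that has to persist between calls; levels and owners are rebuilt
  at each request.\<close>

definition (in expander) loaded :: "(nat \<Rightarrow> nat) \<Rightarrow> mem \<Rightarrow> bool" where
  "loaded p s \<longleftrightarrow> (\<forall>i<nv. \<forall>j<nv. s ''adj'' i j = 0 \<longleftrightarrow> j \<notin> nb i) \<and>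
     (\<forall>i<nv. s ''S'' i 0 = 0 \<longleftrightarrow> i \<notin> R) \<and>
     s ''order'' 0 0 = nv \<and> s ''d'' 0 0 = d \<and> (\<forall>i. s ''par'' i 0 = p i)"

lemma (in expander) loaded_cong:
  assumes "loaded p s" and "\<And>a. a \<in> {''adj'', ''S'', ''order'', ''d'', ''par''} \<Longrightarrow> s' a = s a"
  shows "loaded p s'"
  using assms by (simp add: loaded_def)

section \<open>Correctness and cost of the program\<close>

context position
begin

abbreviation own :: "mem \<Rightarrow> nat \<Rightarrow> nat" where "own s \<equiv> \<lambda>i. s ''own'' i 0"
abbreviation lev :: "mem \<Rightarrow> nat \<Rightarrow> nat" where "lev s \<equiv> \<lambda>i. s ''lev'' i 0"

text \<open>The loop invariant of \<open>inspect\<close>, after the vertices from \<open>k\<close>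
  upwards have been scanned.\<close>

definition inspected :: "mem \<Rightarrow> nat \<Rightarrow> nat \<Rightarrow> mem \<Rightarrow> bool" where
  "inspected s x k s' \<longleftrightarrow>
     (\<forall>a. a \<notin> {''u'', ''owned'', ''taken'', ''free'', ''steal''} \<longrightarrow> s' a = s a) \<and>
     s' ''owned'' 0 0 = card {i \<in> owned (own s) x. k \<le> i} \<and>
     s' ''taken'' 0 0 = card {i \<in> nb x \<inter> taken (own s). k \<le> i} \<and>
     s' ''free'' 0 0 = card {i \<in> nb x - R - taken (own s). k \<le> i} \<and>
     (if s' ''steal'' 0 0 = 0 then \<forall>u\<ge>k. \<not> stealable (lev s) (own s) x u
      else stealable (lev s) (own s) x (s' ''steal'' 0 0 - 1))"

lemma scan_effect:
  assumes s: "loaded par s" "s ''x'' 0 0 = x" "x < nv" and k: "k < nv"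
    and i: "inspected s x (Suc k) s1"
  shows "inspected s x k (effect scan (store ''u'' 0 0 k s1))"
proof -
  let ?S = "store ''u'' 0 0 k s1"
  have frame: "s1 a = s a" if "a \<notin> {''u'', ''owned'', ''taken'', ''free'', ''steal''}" for a
    using i that by (simp add: inspected_def)
  have eqs: "s1 ''own'' = s ''own''" "s1 ''lev'' = s ''lev''" "s1 ''adj'' = s ''adj''"
    "s1 ''S'' = s ''S''" "s1 ''par'' = s ''par''" "s1 ''x'' = s ''x''"
    by (rule frame; simp)+
  have l: "s ''adj'' x k = 0 \<longleftrightarrow> k \<notin> nb x" "s ''S'' k 0 = 0 \<longleftrightarrow> k \<notin> R" "s ''par'' k 0 = par k"
    using s(1,3) k by (simp_all add: loaded_def)
  define o1 where "o1 \<longleftrightarrow> s ''own'' k 0 = Suc x"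
  define o2 where "o2 \<longleftrightarrow> s ''own'' k 0 = 0"
  define b where "b \<longleftrightarrow> s ''lev'' (s ''own'' k 0) 0 < s ''lev'' (Suc x) 0"
  have pos: "0 < s ''adj'' x k \<longleftrightarrow> k \<in> nb x" "0 < s ''S'' k 0 \<longleftrightarrow> k \<in> R" "0 < s ''own'' k 0 \<longleftrightarrow> \<not> o2"
    using l by (auto simp: o2_def)
  note fold = o1_def[symmetric] o2_def[symmetric] b_def[symmetric] pos
  let ?E = "effect scan ?S"
  have E: "?E a = s a" if "a \<notin> {''u'', ''owned'', ''taken'', ''free'', ''steal''}" for a
    using that frame[OF that] by (simp add: scan_def)
  have E1: "?E ''owned'' 0 0 = (if o1 then 1 else 0) + s1 ''owned'' 0 0"
    by (simp add: scan_def eqs s(2) fold)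
  have E2: "?E ''taken'' 0 0 = (if k \<in> nb x \<and> \<not> o2 then 1 else 0) + s1 ''taken'' 0 0"
    by (simp add: scan_def eqs s(2) l fold)
  have E3: "?E ''free'' 0 0 = (if k \<in> nb x \<and> o2 \<and> k \<notin> R then 1 else 0) + s1 ''free'' 0 0"
    by (simp add: scan_def eqs s(2) l fold)
  have E4: "?E ''steal'' 0 0 =
      (if k \<in> nb x \<and> k \<notin> R \<and> par k = 0 \<and> b then Suc k else s1 ''steal'' 0 0)"
    by (simp add: scan_def eqs s(2) l fold)
  have o: "k \<in> owned (own s) x \<longleftrightarrow> o1" "k \<in> taken (own s) \<longleftrightarrow> \<not> o2"
    using k by (simp_all add: owned_def taken_def o1_def o2_def)
  have F1: "?E ''owned'' 0 0 = card {i \<in> owned (own s) x. k \<le> i}"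
    using i unfolding E1 inspected_def by (subst card_from) (simp_all add: o)
  have F2: "?E ''taken'' 0 0 = card {i \<in> nb x \<inter> taken (own s). k \<le> i}"
    using i unfolding E2 inspected_def by (subst card_from) (simp_all add: o)
  have F3: "?E ''free'' 0 0 = card {i \<in> nb x - R - taken (own s). k \<le> i}"
    using i unfolding E3 inspected_def by (subst card_from) (simp_all add: o conj_ac)
  have st: "stealable (lev s) (own s) x k \<longleftrightarrow> k \<in> nb x \<and> k \<notin> R \<and> par k = 0 \<and> b"
    by (auto simp: stealable_def b_def)
  have all: "(\<forall>u\<ge>k. P u) \<longleftrightarrow> P k \<and> (\<forall>u\<ge>Suc k. P u)" for P
    using Suc_le_eq le_less by metis
  have "if ?E ''steal'' 0 0 = 0 then \<forall>u\<ge>k. \<not> stealable (lev s) (own s) x u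
      else stealable (lev s) (own s) x (?E ''steal'' 0 0 - 1)"
  proof (cases "stealable (lev s) (own s) x k")
    case True
    then show ?thesis unfolding E4 using st by simp
  next
    case False
    then have "?E ''steal'' 0 0 = s1 ''steal'' 0 0" unfolding E4 using st by (metis (full_types))
    then show ?thesis using i False unfolding inspected_def all[of "\<lambda>u. \<not> stealable (lev s) (own s) x u"]
      by (simp split: if_splits)
  qed
  then show ?thesis using E F1 F2 F3 unfolding inspected_def by blast
qed

lemma inspect_runs:
  assumes s: "loaded par s" "s ''x'' 0 0 = x" "x < nv"
  shows "runs inspect s (300 * Suc nv) (inspected s x 0)"
proof -
  have less: "u < nv" if "u \<in> nb x" for u using that nb_subset by auto
  then have empty: "{i \<in> owned (own s) x. nv \<le> i} = {}" "{i \<in> nb x \<inter> taken (own s). nv \<le> i} = {}"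
    "{i \<in> nb x - R - taken (own s). nv \<le> i} = {}"
    by (auto simp: owned_def dest: less)
  let ?reset = "Seq (set_scalar ''owned'' (Lit 0)) (Seq (set_scalar ''taken'' (Lit 0))
         (Seq (set_scalar ''free'' (Lit 0)) (set_scalar ''steal'' (Lit 0))))"
  let ?s = "effect ?reset s"
  have init: "inspected s x nv (store ''u'' 0 0 nv ?s)"
    unfolding inspected_def
    unfolding empty by (auto simp: stealable_def dest: less)
  have "runs inspect s (1 + 23 + (7 + Suc nv * (13 + 250))) (inspected s x 0)"
    unfolding inspect_def
  proof (rule runs_Seq[where P = "\<lambda>s'. s' = ?s"])
    show "runs ?reset s 23 (\<lambda>s'. s' = ?s)" by (rule runs_straight) simp_all
    fix s' assume s': "s' = ?s"
    show "runs (For ''u'' scan) s' (7 + Suc nv * (13 + 250)) (inspected s x 0)"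
    proof (rule runs_For[where I = "inspected s x"])
      show "s' ''order'' 0 0 = nv" using s(1) s' by (simp add: loaded_def)
      show "inspected s x nv (store ''u'' 0 0 nv s')" using init s' by simp
      fix k s1 assume k: "k < nv" "inspected s x (Suc k) s1"
      have "effect scan (store ''u'' 0 0 k s1) ''u'' 0 0 = k" by (simp add: scan_def)
      then show "runs scan (store ''u'' 0 0 k s1) 250 (\<lambda>s'. inspected s x k s' \<and> s' ''u'' 0 0 = k)"
        using scan_effect[OF s k] by (intro runs_straight) (simp_all add: scan_def)
    qed auto
  qed
  then show ?thesis by (rule runs_mono) auto
qed

text \<open>The final alternative drives termination: either \<open>x\<close> needs nothing and the
  state is untouched, or the flag is set and the potential grows.\<close>

lemma update_effect:
  assumes s: "loaded par s" "valid (lev s) (own s)" "s ''x'' 0 0 = x" "x < nv"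
    and i: "inspected s x 0 s1"
  defines "s' \<equiv> effect update s1"
  shows "loaded par s'" "valid (lev s') (own s')" "s' ''request'' = s ''request''" "s' ''x'' = s ''x''"
    "\<not> raises (lev s) (own s) x \<and> s' ''changed'' = s ''changed'' \<and> lev s' = lev s \<and> own s' = own s \<or>
     s' ''changed'' 0 0 = 1 \<and> potential (lev s) (own s) < potential (lev s') (own s')"
proof -
  have frame: "s1 a = s a" if "a \<notin> {''u'', ''owned'', ''taken'', ''free'', ''steal''}" for a
    using i that by (simp add: inspected_def)
  have eqs: "s1 ''own'' = s ''own''" "s1 ''lev'' = s ''lev''" "s1 ''x'' = s ''x''" "s1 ''d'' = s ''d''"
    "s1 ''request'' = s ''request''" "s1 ''changed'' = s ''changed''"
    by (rule frame; simp)+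
  have counts: "s1 ''owned'' 0 0 = card (owned (own s) x)"
    "s1 ''free'' 0 0 < s1 ''taken'' 0 0 \<longleftrightarrow> critical (own s) x"
  proof -
    have all: "{i \<in> A. 0 \<le> i} = A" for A :: "nat set" by simp
    show "s1 ''owned'' 0 0 = card (owned (own s) x)"
      "s1 ''free'' 0 0 < s1 ''taken'' 0 0 \<longleftrightarrow> critical (own s) x"
      using i unfolding inspected_def critical_def all by simp_all
  qed
  have d: "s ''d'' 0 0 = d" using s(1) by (simp add: loaded_def)
  have e: "s' = (if raises (lev s) (own s) x then effect improve s1 else s1)"
    by (simp add: s'_def update_def eqs s(3) counts d raises_def)
  have e2: "effect improve s1 = (if s1 ''steal'' 0 0 = 0
      then store ''lev'' (Suc x) 0 (Suc (lev s (Suc x))) (store ''changed'' 0 0 1 s1)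
      else store ''own'' (s1 ''steal'' 0 0 - 1) 0 (Suc x) (store ''changed'' 0 0 1 s1))"
    by (simp add: improve_def eqs s(3))
  show "loaded par s'"
  proof (rule loaded_cong[OF s(1)])
    fix a assume a: "a \<in> {''adj'', ''S'', ''order'', ''d'', ''par''}"
    then have "s1 a = s a" by (intro frame) auto
    moreover have "s' a = s1 a" using a unfolding e e2 by auto
    ultimately show "s' a = s a" by simp
  qed
  show "s' ''request'' = s ''request''" "s' ''x'' = s ''x''"
    by (simp_all add: e e2 eqs)
  have cases: "valid (lev s') (own s') \<and>
    (\<not> raises (lev s) (own s) x \<and> s' ''changed'' = s ''changed'' \<and> lev s' = lev s \<and> own s' = own s \<or>
     s' ''changed'' 0 0 = 1 \<and> potential (lev s) (own s) < potential (lev s') (own s'))"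
  proof (cases "raises (lev s) (own s) x")
    case False
    then show ?thesis using s(2) by (simp add: e eqs)
  next
    case r: True
    show ?thesis
    proof (cases "s1 ''steal'' 0 0 = 0")
      case True
      then have no: "\<not> stealable (lev s) (own s) x u" for u using i by (simp add: inspected_def)
      have "lev s' = (lev s)(Suc x := Suc (lev s (Suc x)))" "own s' = own s" "s' ''changed'' 0 0 = 1"
        using r True by (auto simp: e e2 eqs)
      then show ?thesis using raise_step[OF s(2,4) r no] by simp
    next
      case False
      then have st: "stealable (lev s) (own s) x (s1 ''steal'' 0 0 - 1)" using i by (simp add: inspected_def)
      have "own s' = (own s)(s1 ''steal'' 0 0 - 1 := Suc x)" "lev s' = lev s" "s' ''changed'' 0 0 = 1"
        using r False by (auto simp: e e2 eqs)
      then show ?thesis using steal_step[OF s(2,4) r st] by simp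
    qed
  qed
  then show "valid (lev s') (own s')" and
    "\<not> raises (lev s) (own s) x \<and> s' ''changed'' = s ''changed'' \<and> lev s' = lev s \<and> own s' = own s \<or>
     s' ''changed'' 0 0 = 1 \<and> potential (lev s) (own s) < potential (lev s') (own s')"
    by blast+
qed

text \<open>The invariant of a sweep started in \<open>s0\<close>. The weak inequality covers the
  time before the first change, so that this change can be compared with \<open>s0\<close>.\<close>

definition swept :: "mem \<Rightarrow> nat \<Rightarrow> mem \<Rightarrow> bool" where
  "swept s0 k s \<longleftrightarrow> loaded par s \<and> valid (lev s) (own s) \<and> s ''request'' = s0 ''request'' \<and>
     (if s ''changed'' 0 0 = 0 then \<forall>x. k \<le> x \<and> x < nv \<longrightarrow> \<not> raises (lev s) (own s) x
      else potential (lev s0) (own s0) < potential (lev s) (own s)) \<and>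
     potential (lev s0) (own s0) \<le> potential (lev s) (own s)"

lemma sweep_step:
  assumes k: "k < nv" and r: "swept s0 (Suc k) s"
  shows "runs (Seq inspect update) (store ''x'' 0 0 k s) (500 * Suc nv)
    (\<lambda>s'. swept s0 k s' \<and> s' ''x'' 0 0 = k)"
proof -
  let ?s = "store ''x'' 0 0 k s"
  have l: "loaded par ?s"
    by (rule loaded_cong[of par s]) (use r in \<open>auto simp: swept_def\<close>)
  have v: "valid (lev ?s) (own ?s)" using r by (simp add: swept_def)
  have eqs: "lev ?s = lev s" "own ?s = own s" "?s ''changed'' = s ''changed''"
    "?s ''request'' = s ''request''" "?s ''x'' 0 0 = k"
    by simp_all
  have "runs (Seq inspect update) ?s (1 + 300 * Suc nv + 100) (\<lambda>s'. swept s0 k s' \<and> s' ''x'' 0 0 = k)"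
  proof (rule runs_Seq[OF inspect_runs[OF l eqs(5) k]])
    fix s1 assume i: "inspected ?s k 0 s1"
    let ?s' = "effect update s1"
    note u = update_effect[OF l v eqs(5) k i]
    have less: "k \<le> x \<longleftrightarrow> x = k \<or> Suc k \<le> x" for x by auto
    have "swept s0 k ?s'"
      using u(5)
    proof
      assume "\<not> raises (lev ?s) (own ?s) k \<and> ?s' ''changed'' = ?s ''changed'' \<and>
        lev ?s' = lev ?s \<and> own ?s' = own ?s"
      then show ?thesis using r u(1,2,3) unfolding swept_def eqs less by auto
    next
      assume "?s' ''changed'' 0 0 = 1 \<and> potential (lev ?s) (own ?s) < potential (lev ?s') (own ?s')"
      then show ?thesis using r u(1,2,3) unfolding swept_def eqs by simp
    qed
    moreover have "?s' ''x'' 0 0 = k" using u(4) by simp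
    moreover have "straight update" "max_cost update \<le> 100"
      by (simp_all add: update_def improve_def)
    ultimately show "runs update s1 100 (\<lambda>s'. swept s0 k s' \<and> s' ''x'' 0 0 = k)"
      by (blast intro: runs_straight)
  qed
  then show ?thesis by (rule runs_mono) auto
qed

definition balanced :: "nat \<Rightarrow> mem \<Rightarrow> bool" where
  "balanced v s \<longleftrightarrow> loaded par s \<and> valid (lev s) (own s) \<and> s ''request'' 0 0 = v \<and>
     (s ''changed'' 0 0 = 0 \<longrightarrow> settled (lev s) (own s))"

lemma stabilize_runs:
  assumes s: "balanced v s"
  shows "runs stabilize s (1200 * Suc nv ^ 4) (\<lambda>s'. balanced v s' \<and> settled (lev s') (own s'))"
proof -
  define B where "B = nv * (2 * Suc nv)"
  \<comment> \<open>A sweep clears the flag or increases the potential. \<open>Suc B\<close> keeps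
    the variant positive as long as the flag is set, so clearing the flag decreases it too.\<close>
  define f where "f s = (if s ''changed'' 0 0 = 0 then 0 else Suc B - potential (lev s) (own s))" for s
  let ?body = "Seq (set_scalar ''changed'' (Lit 0)) (For ''x'' (Seq inspect update))"
  have body: "runs ?body s (550 * Suc nv ^ 2) (\<lambda>s'. balanced v s' \<and> f s' < f s)"
    if b: "balanced v s" and c: "eval_exp (scalar ''changed'') s \<noteq> 0" for s
  proof -
    let ?s = "store ''changed'' 0 0 0 s"
    have "loaded par ?s"
      by (rule loaded_cong[of par s]) (use b in \<open>auto simp: balanced_def\<close>)
    then have "loaded par (store ''x'' 0 0 nv ?s)"
      by (rule loaded_cong) auto
    then have init: "swept s nv (store ''x'' 0 0 nv ?s)"
      using b by (auto simp: swept_def balanced_def)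
    have "runs ?body s (1 + 5 + (7 + Suc nv * (13 + 500 * Suc nv)))
        (\<lambda>s'. balanced v s' \<and> f s' < f s)"
    proof (rule runs_Seq[where P = "\<lambda>s'. s' = ?s"])
      show "runs (set_scalar ''changed'' (Lit 0)) s 5 (\<lambda>s'. s' = ?s)"
        by (rule runs_straight) simp_all
      fix s1 assume s1: "s1 = ?s"
      show "runs (For ''x'' (Seq inspect update)) s1 (7 + Suc nv * (13 + 500 * Suc nv))
          (\<lambda>s'. balanced v s' \<and> f s' < f s)"
      proof (rule runs_For[where I = "swept s"])
        show "s1 ''order'' 0 0 = nv" using b s1 by (simp add: balanced_def loaded_def)
        show "swept s nv (store ''x'' 0 0 nv s1)" using init s1 by simp
        fix s' assume r: "swept s 0 s'"
        then have val: "valid (lev s') (own s')" by (simp add: swept_def)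
        have "balanced v s'" using r b by (simp add: swept_def balanced_def settled_def)
        moreover have "potential (lev s) (own s) \<le> B" "potential (lev s') (own s') \<le> B"
          using potential_le[OF val] potential_le[of "lev s" "own s"] b
          unfolding B_def balanced_def by blast+
        then have "f s' < f s" using r c by (auto simp: f_def swept_def split: if_splits)
        ultimately show "balanced v s' \<and> f s' < f s" ..
      qed (use sweep_step in auto)
    qed
    then show ?thesis
      by (rule runs_mono) (simp_all add: power2_eq_square algebra_simps)
  qed
  have "f s \<le> Suc B" by (simp add: f_def)
  then have "Suc (f s) \<le> 2 * Suc nv ^ 2" by (simp add: B_def power2_eq_square)
  moreover have "1 + cost_exp (scalar ''changed'') + 550 * Suc nv ^ 2 \<le> 600 * Suc nv ^ 2"
    by (simp add: power2_eq_square)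
  ultimately have "Suc (f s) * (1 + cost_exp (scalar ''changed'') + 550 * Suc nv ^ 2) \<le>
      2 * Suc nv ^ 2 * (600 * Suc nv ^ 2)"
    by (rule mult_mono) simp_all
  also have "\<dots> = 1200 * Suc nv ^ 4" by (simp flip: power_add)
  finally have T: "Suc (f s) * (1 + cost_exp (scalar ''changed'') + 550 * Suc nv ^ 2) \<le> 1200 * Suc nv ^ 4" .
  have "runs stabilize s (Suc (f s) * (1 + cost_exp (scalar ''changed'') + 550 * Suc nv ^ 2))
      (\<lambda>s'. balanced v s' \<and> settled (lev s') (own s'))"
    unfolding stabilize_def
    by (rule runs_While[where I = "balanced v" and f = f, OF s body]) (simp_all add: balanced_def)
  then show ?thesis by (rule runs_mono[OF _ T])
qed

lemma initialize_runs:
  assumes s: "loaded par s" "s ''request'' 0 0 = v"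
  shows "runs initialize s (100 * Suc nv) (balanced v)"
proof -
  let ?start = "Seq (set_entry ''lev'' (Lit 0) (Lit 0)) (set_scalar ''changed'' (Lit 1))"
  let ?fill = "Seq (set_entry ''own'' (scalar ''u'') (entry ''par'' (scalar ''u'')))
           (set_entry ''lev'' (Add (scalar ''u'') (Lit 1)) (Lit 0))"
  let ?I = "\<lambda>k s'. loaded par s' \<and> s' ''request'' 0 0 = v \<and> s' ''changed'' 0 0 = 1 \<and> lev s' 0 = 0 \<and>
    (\<forall>i. k \<le> i \<longrightarrow> i < nv \<longrightarrow> own s' i = par i \<and> lev s' (Suc i) = 0)"
  have "runs initialize s (1 + 11 + (7 + Suc nv * (13 + 24))) (balanced v)"
    unfolding initialize_def
  proof (rule runs_Seq[where P = "\<lambda>s'. s' = effect ?start s"])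
    show "runs ?start s 11 (\<lambda>s'. s' = effect ?start s)" by (rule runs_straight) simp_all
    fix s1 assume s1: "s1 = effect ?start s"
    show "runs (For ''u'' ?fill) s1 (7 + Suc nv * (13 + 24)) (balanced v)"
    proof (rule runs_For[where I = ?I])
      show "s1 ''order'' 0 0 = nv" using s s1 by (simp add: loaded_def)
      show "?I nv (store ''u'' 0 0 nv s1)" using s by (simp add: s1 loaded_def)
      fix k s2 assume k: "k < nv" and I: "?I (Suc k) s2"
      have less: "k \<le> i \<longleftrightarrow> i = k \<or> Suc k \<le> i" for i by auto
      have "?I k (effect ?fill (store ''u'' 0 0 k s2))"
        using I unfolding less by (auto simp: loaded_def)
      then show "runs ?fill (store ''u'' 0 0 k s2) 24 (\<lambda>s'. ?I k s' \<and> s' ''u'' 0 0 = k)"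
        by (intro runs_straight) simp_all
    next
      fix s' assume I: "?I 0 s'"
      have "lev s' x = 0" if "x \<le> nv" for x using that I by (cases x) auto
      then have "valid (lev s') (own s')" using I by (intro valid_init) simp_all
      then show "balanced v s'" using I by (simp add: balanced_def)
    qed simp
  qed
  then show ?thesis by (rule runs_mono) auto
qed

lemma select_runs:
  assumes s: "balanced v s" "settled (lev s) (own s)" and v: "v < nv" "card {i. par i = Suc v} < d"
  shows "runs select s (150 * Suc nv)
    (\<lambda>s'. loaded par s' \<and> s' ''request'' 0 0 = v \<and> reply (lev s) (own s) v (s' ''answer'' 0 0))"
proof -
  let ?start = "Cond (entry ''lev'' (Add (scalar ''request'') (Lit 1)))
         (set_scalar ''want'' (Add (scalar ''request'') (Lit 1))) (set_scalar ''want'' (Lit 0))"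
  let ?try = "Cond (Read ''adj'' (scalar ''request'') (scalar ''u''))
           (Cond (entry ''S'' (scalar ''u'')) Skip
             (Cond (entry ''par'' (scalar ''u'')) Skip
               (Cond (Equal (entry ''own'' (scalar ''u'')) (scalar ''want''))
                 (set_scalar ''answer'' (scalar ''u'')) Skip)))
           Skip"
  let ?w = "if lev s (Suc v) = 0 then 0 else Suc v"
  let ?R = "reply (lev s) (own s) v"
  \<comment> \<open>Later hits may overwrite the answer, but only by another reply; that a reply
    exists is supplied by \<open>reply_exists\<close> at the end of the loop.\<close>
  let ?I = "\<lambda>k s'. loaded par s' \<and> s' ''request'' 0 0 = v \<and> s' ''own'' = s ''own'' \<and> s' ''want'' 0 0 = ?w \<and>
    ((\<exists>u\<ge>k. u < nv \<and> ?R u) \<longrightarrow> ?R (s' ''answer'' 0 0))"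
  have b: "loaded par s" "s ''request'' 0 0 = v" using s(1) by (simp_all add: balanced_def)
  have "runs select s (1 + 24 + (7 + Suc nv * (13 + 60)))
      (\<lambda>s'. loaded par s' \<and> s' ''request'' 0 0 = v \<and> ?R (s' ''answer'' 0 0))"
    unfolding select_def
  proof (rule runs_Seq[where P = "\<lambda>s'. s' = store ''want'' 0 0 ?w s"])
    show "runs ?start s 24 (\<lambda>s'. s' = store ''want'' 0 0 ?w s)"
      by (rule runs_straight) (simp_all add: b)
    fix s1 assume s1: "s1 = store ''want'' 0 0 ?w s"
    show "runs (For ''u'' ?try) s1 (7 + Suc nv * (13 + 60))
        (\<lambda>s'. loaded par s' \<and> s' ''request'' 0 0 = v \<and> ?R (s' ''answer'' 0 0))"
    proof (rule runs_For[where I = ?I])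
      show "s1 ''order'' 0 0 = nv" using b s1 by (simp add: loaded_def)
      show "?I nv (store ''u'' 0 0 nv s1)" using b by (auto simp: s1 loaded_def)
      fix k s2 assume k: "k < nv" and I: "?I (Suc k) s2"
      let ?s = "store ''u'' 0 0 k s2"
      have l: "s2 ''adj'' v k = 0 \<longleftrightarrow> k \<notin> nb v" "s2 ''S'' k 0 = 0 \<longleftrightarrow> k \<notin> R" "s2 ''par'' k 0 = par k"
        using I k v(1) by (simp_all add: loaded_def)
      have "effect ?try ?s = (if ?R k then store ''answer'' 0 0 k ?s else ?s)"
        using I l by (auto simp: reply_def)
      moreover have "loaded par ?s" "loaded par (store ''answer'' 0 0 k ?s)"
        using I by (simp_all add: loaded_def)
      moreover have less: "k \<le> u \<longleftrightarrow> u = k \<or> Suc k \<le> u" for u by auto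
      ultimately have "?I k (effect ?try ?s) \<and> effect ?try ?s ''u'' 0 0 = k"
        using I unfolding less by auto
      then show "runs ?try ?s 60 (\<lambda>s'. ?I k s' \<and> s' ''u'' 0 0 = k)"
        by (intro runs_straight) simp_all
    next
      fix s' assume I: "?I 0 s'"
      obtain u where "?R u" using reply_exists[OF s(2) v] by blast
      moreover have "u < nv" using calculation nb_subset by (auto simp: reply_def)
      ultimately show "loaded par s' \<and> s' ''request'' 0 0 = v \<and> ?R (s' ''answer'' 0 0)"
        using I by blast
    qed simp
  qed
  then show ?thesis by (rule runs_mono) auto
qed

lemma respond_runs:
  assumes s: "loaded par s" "s ''request'' 0 0 = v" and v: "v < nv" "card {i. par i = Suc v} < d"
  shows "runs respond s (1500 * Suc nv ^ 4) (\<lambda>s'. \<exists>u. loaded (par(u := Suc v)) s' \<and>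
    s' ''answer'' 0 0 = u \<and> u \<in> nb v \<and> u \<notin> R \<and> par u = 0 \<and> hall (par(u := Suc v)))"
    (is "runs _ _ _ ?Q")
proof -
  let ?write = "set_entry ''par'' (scalar ''answer'') (Add (scalar ''request'') (Lit 1))"
  have "runs (Seq select ?write) s1 (1 + 150 * Suc nv + 20) ?Q"
    if s1: "balanced v s1 \<and> settled (lev s1) (own s1)" for s1
  proof (rule runs_Seq[OF select_runs[OF conjunct1[OF s1] conjunct2[OF s1] v]])
    fix s2
    assume s2: "loaded par s2 \<and> s2 ''request'' 0 0 = v \<and> reply (lev s1) (own s1) v (s2 ''answer'' 0 0)"
    then have "hall (par(s2 ''answer'' 0 0 := Suc v))" using hall_reply s1 by blast
    then have "?Q (effect ?write s2)" using s2 by (simp add: loaded_def reply_def)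
    then show "runs ?write s2 20 ?Q" by (intro runs_straight) simp_all
  qed
  then have "runs (Seq stabilize (Seq select ?write)) s1
      (1 + 1200 * Suc nv ^ 4 + (1 + 150 * Suc nv + 20)) ?Q" if "balanced v s1" for s1
    by (rule runs_Seq[OF stabilize_runs[OF that]])
  then have "runs respond s (1 + 100 * Suc nv + (1 + 1200 * Suc nv ^ 4 + (1 + 150 * Suc nv + 20))) ?Q"
    unfolding respond_def by (rule runs_Seq[OF initialize_runs[OF s]])
  then show ?thesis
  proof (rule runs_mono)
    have "Suc nv ^ 1 \<le> Suc nv ^ 4" by (rule power_increasing) simp_all
    then show "1 + 100 * Suc nv + (1 + 1200 * Suc nv ^ 4 + (1 + 150 * Suc nv + 20)) \<le> 1500 * Suc nv ^ 4"
      by simp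
  qed
qed

end

section \<open>Playing the game\<close>

lemma inj_doubleton: "inj_on (\<lambda>y. {x, y}) A"
  by (auto simp: inj_on_def doubleton_eq_iff)

lemma deg_eq_card_nbrs:
  assumes "simple_graph G"
  shows "deg G x = card (nbrs G x)"
proof -
  have "\<exists>y\<in>nbrs G x. e = {x, y}" if e: "e \<in> edges G" "x \<in> e" for e
  proof -
    obtain y z where yz: "e = {y, z}" using e(1) assms unfolding simple_graph_def by blast
    show ?thesis
    proof (cases "x = y")
      case True
      then show ?thesis using e(1) yz by (intro bexI[of _ z]) (simp_all add: nbrs_def)
    next
      case False
      then have "e = {x, y}" using e(2) yz by (simp add: insert_commute)
      then show ?thesis using e(1) by (intro bexI[of _ y]) (simp_all add: nbrs_def)
    qed
  qed
  then have "incident G x \<subseteq> (\<lambda>y. {x, y}) ` nbrs G x" unfolding incident_def by blast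
  moreover have "(\<lambda>y. {x, y}) ` nbrs G x \<subseteq> incident G x"
    unfolding incident_def nbrs_def by blast
  ultimately have "incident G x = (\<lambda>y. {x, y}) ` nbrs G x" by (rule subset_antisym)
  then show ?thesis by (simp add: deg_def card_image[OF inj_doubleton])
qed

text \<open>No preprocessing is done: in the input memory \<open>par\<close> is 0 everywhere, which
  represents the edgeless forest. A removal only clears one parent entry.\<close>

definition player :: algorithm where
  "player = \<lparr>on_start = Skip, on_request = respond,
     on_removal = set_entry ''par'' (scalar ''removed'') (Lit 0)\<rparr>"

locale game =
  fixes \<alpha> \<beta> :: real and n d :: nat and G :: "'a graph" and S :: "'a set" and \<nu> :: "'a \<Rightarrow> nat"
  assumes \<beta>: "\<beta> < 2 * \<alpha> - 1"
    and simple: "simple_graph G" and P: "property_P \<alpha> n d G"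
    and S: "S \<subseteq> verts G" "S \<noteq> {}"
    and sparse: "\<And>x. x \<in> verts G \<Longrightarrow> real (card (nbrs G x \<inter> S)) \<le> \<beta> * real (deg G x)"
    and \<nu>: "bij_betw \<nu> (verts G) {..<card (verts G)}"
    and pos: "0 < n" "0 < d"
begin

section \<open>From the graph to numbered vertices\<close>

definition nv :: nat where "nv = card (verts G)"
definition \<mu> :: "nat \<Rightarrow> 'a" where "\<mu> = inv_into (verts G) \<nu>"
definition nb :: "nat \<Rightarrow> nat set" where "nb i = {\<nu> y |x y. {x, y} \<in> edges G \<and> \<nu> x = i}"

lemma finite_V: "finite (verts G)"
  using simple by (simp add: simple_graph_def)

lemma \<nu>_inj: "inj_on \<nu> (verts G)"
  using \<nu> by (simp add: bij_betw_def)

lemma \<nu>_less: "x \<in> verts G \<Longrightarrow> \<nu> x < nv"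
  using bij_betwE[OF \<nu>] by (auto simp: nv_def)

lemma \<mu>_\<nu> [simp]: "x \<in> verts G \<Longrightarrow> \<mu> (\<nu> x) = x"
  by (simp add: \<mu>_def inv_into_f_f[OF \<nu>_inj])

lemma \<nu>_\<mu> [simp]: "i < nv \<Longrightarrow> \<nu> (\<mu> i) = i"
  using f_inv_into_f[of i \<nu> "verts G"] bij_betw_imp_surj_on[OF \<nu>] by (simp add: \<mu>_def nv_def)

lemma \<mu>_V: "i < nv \<Longrightarrow> \<mu> i \<in> verts G"
  using inv_into_into[of i \<nu> "verts G"] bij_betw_imp_surj_on[OF \<nu>] by (simp add: \<mu>_def nv_def)

lemma edgeD:
  assumes "{x, y} \<in> edges G"
  shows "x \<in> verts G" "y \<in> verts G" "x \<noteq> y"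
proof -
  obtain a b where "a \<in> verts G" "b \<in> verts G" "a \<noteq> b" "{x, y} = {a, b}"
    using simple assms unfolding simple_graph_def by blast
  then show "x \<in> verts G" "y \<in> verts G" "x \<noteq> y" by (auto simp: doubleton_eq_iff)
qed

lemma nbrs_V: "nbrs G x \<subseteq> verts G"
  by (auto simp: nbrs_def dest: edgeD)

lemma nbE:
  assumes "j \<in> nb i"
  obtains x y where "{x, y} \<in> edges G" "x \<in> verts G" "y \<in> verts G" "i = \<nu> x" "j = \<nu> y"
  using assms edgeD unfolding nb_def by blast

lemma nb_\<nu>:
  assumes x: "x \<in> verts G"
  shows "nb (\<nu> x) = \<nu> ` nbrs G x"
proof
  show "nb (\<nu> x) \<subseteq> \<nu> ` nbrs G x"
  proof
    fix j assume "j \<in> nb (\<nu> x)"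
    then obtain x' y where e: "{x', y} \<in> edges G" "x' \<in> verts G" "\<nu> x = \<nu> x'" "j = \<nu> y"
      by (rule nbE)
    then have "x' = x" using x inj_onD[OF \<nu>_inj] by metis
    then show "j \<in> \<nu> ` nbrs G x" using e by (simp add: nbrs_def)
  qed
qed (auto simp: nb_def nbrs_def)

lemma nb_less: "j \<in> nb i \<Longrightarrow> i < nv \<and> j < nv"
  by (erule nbE) (simp add: \<nu>_less)

lemma nb_edge: "j \<in> nb i \<Longrightarrow> {\<mu> i, \<mu> j} \<in> edges G"
  by (erule nbE) simp

lemma card_nb_Int:
  assumes x: "x \<in> verts G" and A: "A \<subseteq> verts G"
  shows "card (nb (\<nu> x) \<inter> \<nu> ` A) = card (nbrs G x \<inter> A)"
proof -
  have "nb (\<nu> x) \<inter> \<nu> ` A = \<nu> ` (nbrs G x \<inter> A)"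
    unfolding nb_\<nu>[OF x] using nbrs_V A by (intro inj_on_image_Int[OF \<nu>_inj, symmetric]) auto
  then show ?thesis
    using nbrs_V by (simp add: card_image[OF inj_on_subset[OF \<nu>_inj]] le_infI1)
qed

text \<open>Delete the edges \<open>F\<close> from \<open>X\<close> to \<open>W - X\<close>, where
  \<open>W\<close> corresponds to \<open>U\<close>. At each vertex of \<open>X\<close> these number
  at most (1 + \<beta>) / 2 \<le> \<alpha> times the degree, and every remaining neighbour of
  \<open>X\<close> lies outside \<open>W\<close>.\<close>

lemma expansion:
  assumes Z: "Z \<subseteq> {..<nv}" "card Z \<le> n"
    and U: "\<And>z. z \<in> Z \<Longrightarrow> 2 * card (nb z \<inter> U) \<le> card (nb z) + card (nb z \<inter> \<nu> ` S)"
  shows "2 * d * card Z \<le> card (\<Union>(nb ` Z) - U)"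
proof -
  define X where "X = \<mu> ` Z"
  define W where "W = {x \<in> verts G. \<nu> x \<in> U}"
  \<comment> \<open>Edges inside \<open>X\<close> are spared: one with only one end in
    \<open>W\<close> would also be charged to that end, although it does not lead from there into
    \<open>W\<close>.\<close>
  define F where "F = {{x, y} |x y. x \<in> X \<and> y \<in> W - X} \<inter> edges G"
  have "\<nu> (\<mu> i) = i" if "i \<in> Z" for i using Z(1) that by (intro \<nu>_\<mu>) auto
  then have ZX: "Z = \<nu> ` X" unfolding X_def image_image by simp
  have XV: "X \<subseteq> verts G" unfolding X_def using Z(1) \<mu>_V by blast
  have cX: "card X = card Z" unfolding ZX by (rule card_image[symmetric, OF inj_on_subset[OF \<nu>_inj XV]])
  have few: "real (card (F \<inter> incident G x)) \<le> \<alpha> * real (deg G x)" if x: "x \<in> X" for x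
  proof -
    have xV: "x \<in> verts G" using x XV by auto
    have "F \<inter> incident G x \<subseteq> (\<lambda>y. {x, y}) ` (nbrs G x \<inter> W)"
      using x by (auto simp: F_def incident_def nbrs_def insert_commute)
    then have "card (F \<inter> incident G x) \<le> card ((\<lambda>y. {x, y}) ` (nbrs G x \<inter> W))"
      using finite_V by (intro card_mono) (auto simp: W_def)
    also have "\<dots> = card (nbrs G x \<inter> W)" by (rule card_image[OF inj_doubleton])
    also have "\<dots> = card (nb (\<nu> x) \<inter> \<nu> ` W)" by (rule card_nb_Int[OF xV, symmetric]) (auto simp: W_def)
    also have "nb (\<nu> x) \<inter> \<nu> ` W = nb (\<nu> x) \<inter> U"
      unfolding nb_\<nu>[OF xV] using nbrs_V by (auto simp: W_def)
    finally have "2 * card (F \<inter> incident G x) \<le> card (nb (\<nu> x)) + card (nb (\<nu> x) \<inter> \<nu> ` S)"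
      using U[of "\<nu> x"] x ZX by fastforce
    also have "card (nb (\<nu> x)) = deg G x"
      unfolding nb_\<nu>[OF xV] deg_eq_card_nbrs[OF simple]
      by (rule card_image[OF inj_on_subset[OF \<nu>_inj nbrs_V]])
    also have "card (nb (\<nu> x) \<inter> \<nu> ` S) = card (nbrs G x \<inter> S)" by (rule card_nb_Int[OF xV S(1)])
    finally have "2 * real (card (F \<inter> incident G x)) \<le> real (deg G x) + real (card (nbrs G x \<inter> S))"
      by linarith
    also have "\<dots> \<le> (1 + \<beta>) * real (deg G x)" using sparse[OF xV] by (simp add: algebra_simps)
    also have "\<dots> \<le> (2 * \<alpha>) * real (deg G x)" using \<beta> by (intro mult_right_mono) auto
    finally show ?thesis by simp
  qed
  have "2 * d * card X \<le> card (nbrs_of_set (delete_edges G F) X)"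
  proof -
    have "F \<subseteq> edges G" by (simp add: F_def)
    moreover have "card X \<le> n" using cX Z(2) by simp
    ultimately show ?thesis using P XV few unfolding property_P_def by blast
  qed
  also have "nbrs_of_set (delete_edges G F) X \<subseteq> (\<Union>x\<in>X. nbrs G x) - W"
    unfolding nbrs_of_set_def delete_edges_def nbrs_def F_def by auto
  then have "card (nbrs_of_set (delete_edges G F) X) \<le> card ((\<Union>x\<in>X. nbrs G x) - W)"
    by (rule card_mono[rotated]) (rule finite_subset[OF _ finite_V]; use nbrs_V in blast)
  also have "\<dots> = card (\<nu> ` ((\<Union>x\<in>X. nbrs G x) - W))"
    using nbrs_V by (intro card_image[symmetric] inj_on_subset[OF \<nu>_inj]) blast
  also have "\<nu> ` ((\<Union>x\<in>X. nbrs G x) - W) \<subseteq> \<Union>(nb ` Z) - U"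
  proof
    fix j assume "j \<in> \<nu> ` ((\<Union>x\<in>X. nbrs G x) - W)"
    then obtain x y where xy: "x \<in> X" "y \<in> nbrs G x" "y \<notin> W" "j = \<nu> y" by blast
    then have "j \<in> nb (\<nu> x)" using nb_\<nu> XV by blast
    moreover have "j \<notin> U" using xy nbrs_V by (auto simp: W_def)
    ultimately show "j \<in> \<Union>(nb ` Z) - U" using xy(1) ZX by blast
  qed
  then have "card (\<nu> ` ((\<Union>x\<in>X. nbrs G x) - W)) \<le> card (\<Union>(nb ` Z) - U)"
    by (rule card_mono[rotated]) (rule finite_subset[of _ "{..<nv}"]; use nb_less in blast)
  finally show ?thesis using cX by simp
qed

sublocale expander nv n d nb "\<nu> ` S"
  using nb_less expansion pos by unfold_locales auto

lemma nv_pos: "0 < nv"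
  using S finite_V by (auto simp: nv_def card_gt_0_iff)

section \<open>Forests as parent arrays\<close>

definition link :: "(nat \<Rightarrow> nat) \<Rightarrow> nat \<Rightarrow> 'a set" where
  "link p i = {\<mu> i, \<mu> (p i - 1)}"

text \<open>\<open>p\<close> describes \<open>T\<close> as a forest rooted at \<open>S\<close>. The
  bijection assigns to each non-root its parent edge, which turns edge counts into counts of nonzero
  entries.\<close>

definition tracks :: "(nat \<Rightarrow> nat) \<Rightarrow> 'a graph \<Rightarrow> bool" where
  "tracks p T \<longleftrightarrow> (\<forall>i. p i \<noteq> 0 \<longrightarrow> i \<notin> \<nu> ` S \<and> i \<in> nb (p i - 1) \<and> \<mu> (p i - 1) \<in> verts T) \<and>
     verts T = S \<union> \<mu> ` {i. p i \<noteq> 0} \<and> bij_betw (link p) {i. p i \<noteq> 0} (edges T) \<and>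
     (\<forall>x. card {i. p i = Suc x} \<le> d) \<and> hall p"

lemma tracksD:
  assumes "tracks p T"
  shows "p i \<noteq> 0 \<Longrightarrow> i \<notin> \<nu> ` S" "p i \<noteq> 0 \<Longrightarrow> i \<in> nb (p i - 1)"
    "p i \<noteq> 0 \<Longrightarrow> \<mu> (p i - 1) \<in> verts T"
    "verts T = S \<union> \<mu> ` {i. p i \<noteq> 0}" "bij_betw (link p) {i. p i \<noteq> 0} (edges T)"
    "card {i. p i = Suc x} \<le> d" "hall p"
  using assms unfolding tracks_def by blast+

lemma tracks_less:
  assumes "tracks p T" "p i \<noteq> 0"
  shows "i < nv" "p i - 1 < nv" "p i \<le> nv"
  using nb_less[OF tracksD(2)[OF assms]] assms(2) by auto

lemma tracks_verts:
  assumes "tracks p T"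
  shows "verts T \<subseteq> verts G"
proof -
  have "\<mu> i \<in> verts G" if "p i \<noteq> 0" for i by (rule \<mu>_V[OF tracks_less(1)[OF assms that]])
  then show ?thesis using tracksD(4)[OF assms] S(1) by auto
qed

lemma tracks_finite:
  assumes "tracks p T"
  shows "finite {i. p i \<noteq> 0}"
  by (rule finite_subset[of _ "{..<nv}"]) (use tracks_less(1)[OF assms] in auto)

lemma finite_children:
  assumes "tracks p T"
  shows "finite {i. p i = Suc x}"
  by (rule finite_subset[OF _ tracks_finite[OF assms]]) auto

lemma tracks_mem:
  assumes "tracks p T" "x \<in> verts T" "x \<notin> S"
  shows "p (\<nu> x) \<noteq> 0"
  using assms(2,3) tracksD(4)[OF assms(1)] tracks_less(1)[OF assms(1)] by auto

lemma tracks_fresh: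
  assumes T: "tracks p T" and u: "u < nv" "u \<notin> \<nu> ` S" "p u = 0"
  shows "\<mu> u \<notin> verts T"
proof
  assume "\<mu> u \<in> verts T"
  moreover have "\<mu> u \<notin> S" using u(2) \<nu>_\<mu>[OF u(1)] by (metis image_eqI)
  ultimately show False using tracks_mem[OF T, of "\<mu> u"] u by simp
qed

lemma tracks_card: "tracks p T \<Longrightarrow> card (edges T) = card {i. p i \<noteq> 0}"
  using bij_betw_same_card[OF tracksD(5)] by simp

lemma tracks_position:
  assumes "tracks p T" "card (edges T) < d * n"
  shows "position nv n d nb (\<nu> ` S) p"
  by unfold_locales
    (use tracksD(1,6,7)[OF assms(1)] tracks_less[OF assms(1)] tracks_card[OF assms(1)] assms(2) in auto)

text \<open>The parent edges of the children are distinct edges at \<open>v\<close>. This transfers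
  the degree limit on requests to the number of children.\<close>

lemma children_le_deg:
  assumes T: "tracks p T" and v: "v \<in> verts T"
  shows "card {i. p i = Suc (\<nu> v)} \<le> deg T v"
proof -
  have sub: "{i. p i = Suc (\<nu> v)} \<subseteq> {i. p i \<noteq> 0}" by auto
  have vG: "v \<in> verts G" using v tracks_verts[OF T] by auto
  have inj: "inj_on (link p) {i. p i \<noteq> 0}" and im: "link p ` {i. p i \<noteq> 0} = edges T"
    using tracksD(5)[OF T] by (auto simp: bij_betw_def)
  have "link p ` {i. p i = Suc (\<nu> v)} \<subseteq> incident T v"
    using im vG by (fastforce simp: incident_def link_def)
  moreover have "finite (incident T v)"
    by (rule finite_subset[of _ "edges T"]) (use im[symmetric] tracks_finite[OF T] in \<open>auto simp: incident_def\<close>)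
  ultimately show ?thesis
    unfolding deg_def using card_inj_on_le[OF inj_on_subset[OF inj sub]] by blast
qed

lemma tracks_init: "tracks (\<lambda>_. 0) (S, {})"
  using hall_init by (simp add: tracks_def bij_betw_def)

lemma tracks_add:
  assumes T: "tracks p T" and v: "v \<in> verts T" "deg T v < d"
    and u: "u \<in> nb (\<nu> v)" "u \<notin> \<nu> ` S" "p u = 0" and h: "hall (p(u := Suc (\<nu> v)))"
  shows "tracks (p(u := Suc (\<nu> v))) (add_leaf T v (\<mu> u))"
proof -
  let ?p = "p(u := Suc (\<nu> v))"
  have vG: "v \<in> verts G" using v tracks_verts[OF T] by auto
  have un: "u < nv" using nb_less[OF u(1)] by simp
  have nz: "{i. ?p i \<noteq> 0} = insert u {i. p i \<noteq> 0}" by auto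
  have new: "\<mu> u \<notin> verts T" by (rule tracks_fresh[OF T un u(2,3)])
  have old: "link ?p i = link p i" if "p i \<noteq> 0" for i using that u(3) by (auto simp: link_def)
  have im: "link p ` {i. p i \<noteq> 0} = edges T" using tracksD(5)[OF T] by (simp add: bij_betw_def)
  have sub: "link p i \<subseteq> verts T" if "p i \<noteq> 0" for i
    using tracksD(3)[OF T that] tracksD(4)[OF T] that by (auto simp: link_def)
  have lu: "link ?p u = {v, \<mu> u}" using vG by (auto simp: link_def)
  have "bij_betw (link p) {i. p i \<noteq> 0} (edges T)" by (rule tracksD(5)[OF T])
  then have "bij_betw (link ?p) {i. p i \<noteq> 0} (edges T)"
    using old by (subst bij_betw_cong[where g = "link p"]) auto
  moreover have "link ?p u \<notin> edges T"
  proof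
    assume "link ?p u \<in> edges T"
    then obtain i where "p i \<noteq> 0" "link ?p u = link p i" unfolding im[symmetric] by blast
    then have "{v, \<mu> u} \<subseteq> verts T" using sub[of i] lu by metis
    then show False using new by simp
  qed
  ultimately have bij: "bij_betw (link ?p) {i. ?p i \<noteq> 0} (edges (add_leaf T v (\<mu> u)))"
    unfolding nz using u(3) notIn_Un_bij_betw[of u "{i. p i \<noteq> 0}" "link ?p" "edges T"]
    by (simp add: add_leaf_def lu)
  have ch: "card {i. ?p i = Suc x} \<le> d" for x
  proof (cases "x = \<nu> v")
    case True
    have "card {i. ?p i = Suc x} \<le> card (insert u {i. p i = Suc (\<nu> v)})"
      using finite_children[OF T] True by (intro card_mono) auto
    also have "\<dots> \<le> Suc (card {i. p i = Suc (\<nu> v)})" by (rule card_insert_le_m1) auto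
    also have "\<dots> \<le> d" using children_le_deg[OF T v(1)] v(2) by simp
    finally show ?thesis .
  next
    case False
    then have "{i. ?p i = Suc x} = {i. p i = Suc x}" using u(3) by auto
    then show ?thesis using tracksD(6)[OF T] by simp
  qed
  have verts: "verts (add_leaf T v (\<mu> u)) = insert (\<mu> u) (verts T)" by (simp add: add_leaf_def)
  have vs: "verts (add_leaf T v (\<mu> u)) = S \<union> \<mu> ` {i. ?p i \<noteq> 0}"
    unfolding verts nz tracksD(4)[OF T] by blast
  have par: "i \<notin> \<nu> ` S \<and> i \<in> nb (?p i - 1) \<and> \<mu> (?p i - 1) \<in> verts (add_leaf T v (\<mu> u))"
    if "?p i \<noteq> 0" for i
  proof (cases "i = u")
    case True
    then show ?thesis using u(1,2) v(1) vG unfolding verts by simp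
  next
    case False
    then show ?thesis using that tracksD(1,2,3)[OF T, of i] unfolding verts by simp
  qed
  show ?thesis
    unfolding tracks_def by (intro conjI allI impI vs bij ch h) (use par in blast)+
qed

text \<open>The single edge at \<open>w\<close> is its parent edge, so \<open>w\<close> has no
  children and \<open>hall_remove\<close> applies.\<close>

lemma tracks_remove:
  assumes T: "tracks p T" and w: "w \<in> verts T" "w \<notin> S" "deg T w = 1"
  shows "tracks (p(\<nu> w := 0)) (delete_vertex T w)"
proof -
  let ?p = "p(\<nu> w := 0)"
  let ?i = "\<nu> w"
  have wG: "w \<in> verts G" using w tracks_verts[OF T] by auto
  have pw: "p ?i \<noteq> 0" by (rule tracks_mem[OF T w(1,2)])
  have inj: "inj_on (link p) {i. p i \<noteq> 0}" and im: "link p ` {i. p i \<noteq> 0} = edges T"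
    using tracksD(5)[OF T] by (auto simp: bij_betw_def)
  have mem: "link p i \<in> incident T w" if "p i \<noteq> 0" "w \<in> link p i" for i
    using that unfolding incident_def im[symmetric] by blast
  have wi: "link p ?i \<in> incident T w" using pw wG by (intro mem) (simp_all add: link_def)
  then have inc: "incident T w = {link p ?i}"
    using w(3) unfolding deg_def by (elim card_1_singletonE) simp
  have irr: "?i \<notin> nb ?i" using nb_edge[of ?i ?i] edgeD(3)[of "\<mu> ?i" "\<mu> ?i"] by auto
  \<comment> \<open>The parent edge of a child would coincide with that of \<open>w\<close>; by
    injectivity the child would be \<open>w\<close> itself, adjacent to itself.\<close>
  have leaf: "p i \<noteq> Suc ?i" for i
  proof
    assume pi: "p i = Suc ?i"
    then have "link p i \<in> incident T w" using wG by (intro mem) (simp_all add: link_def)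
    then have "link p i = link p ?i" using inc by simp
    then have "i = ?i" using pi pw by (intro inj_onD[OF inj]) simp_all
    then show False using tracksD(2)[OF T, of i] pi irr by simp
  qed
  have nz: "{i. ?p i \<noteq> 0} = {i. p i \<noteq> 0} - {?i}" by auto
  have "bij_betw (link p) ({i. p i \<noteq> 0} - {?i}) (edges T - {link p ?i})"
    using tracksD(5)[OF T] pw im by (intro bij_betw_DiffI) (blast | simp add: bij_betw_def)+
  then have bij: "bij_betw (link ?p) {i. ?p i \<noteq> 0} (edges (delete_vertex T w))"
    unfolding nz delete_vertex_def inc by (subst bij_betw_cong[where g = "link p"]) (auto simp: link_def)
  have ch: "card {i. ?p i = Suc x} \<le> d" for x
  proof -
    have "card {i. ?p i = Suc x} \<le> card {i. p i = Suc x}"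
      using finite_children[OF T] by (intro card_mono) auto
    then show ?thesis using tracksD(6)[OF T, of x] by simp
  qed
  have h: "hall ?p"
    by (rule hall_remove[OF tracksD(7)[OF T] tracks_finite[OF T] tracksD(2)[OF T pw] tracksD(1)[OF T pw] leaf])
  have vs: "verts (delete_vertex T w) = S \<union> \<mu> ` {i. ?p i \<noteq> 0}"
  proof -
    have "\<mu> i \<noteq> w" if "p i \<noteq> 0" "i \<noteq> ?i" for i using that tracks_less(1)[OF T that(1)] by auto
    then show ?thesis unfolding nz using tracksD(4)[OF T] w(2) wG by (auto simp: delete_vertex_def)
  qed
  have par: "\<mu> (p i - 1) \<in> verts (delete_vertex T w)" if "p i \<noteq> 0" for i
  proof -
    have "\<mu> (p i - 1) \<noteq> w" using leaf[of i] that \<nu>_\<mu>[OF tracks_less(2)[OF T that]] by auto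
    then show ?thesis using tracksD(3)[OF T that] by (simp add: delete_vertex_def)
  qed
  show ?thesis
    unfolding tracks_def
  proof (intro conjI allI impI)
    fix i assume "?p i \<noteq> 0"
    then have "?p i = p i" "p i \<noteq> 0" by (auto split: if_splits)
    then show "i \<notin> \<nu> ` S" "i \<in> nb (?p i - 1)" "\<mu> (?p i - 1) \<in> verts (delete_vertex T w)"
      using tracksD(1,2)[OF T] par by simp_all
  qed (use vs bij ch h in blast)+
qed

text \<open>Each removal costs 6 operations and shrinks the vertex set, so a whole batch stays
  linear in the number of vertices.\<close>

lemma tracks_removals:
  assumes "removals S T ws T'" "tracks p T" "loaded p s"
  shows "\<exists>t s' p'. exec_removals player \<nu> ws s t s' \<and> t = 6 * length ws \<and>
    length ws \<le> card (verts T) \<and> tracks p' T' \<and> loaded p' s' \<and> edges T' \<subseteq> edges T"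
  using assms
proof (induction arbitrary: p s rule: removals.induct)
  case (Nil T)
  then show ?case using exec_removals.Nil[of player \<nu> s] by fastforce
next
  case (Cons w T ws T')
  let ?s = "store ''par'' (\<nu> w) 0 0 (store ''removed'' 0 0 (\<nu> w) s)"
  have T: "tracks (p(\<nu> w := 0)) (delete_vertex T w)" using tracks_remove Cons by blast
  have "loaded (p(\<nu> w := 0)) ?s" using Cons.prems(2) by (simp add: loaded_def)
  from Cons.IH[OF T this] obtain s' p' where IH: "exec_removals player \<nu> ws ?s (6 * length ws) s'"
    "length ws \<le> card (verts (delete_vertex T w))" "tracks p' T'" "loaded p' s'"
    "edges T' \<subseteq> edges (delete_vertex T w)" by blast
  have "exec (on_removal player) (store ''removed'' 0 0 (\<nu> w) s) 6 ?s"
    using exec.Assign[of "''par''" "scalar ''removed''" "Lit 0" "Lit 0" "store ''removed'' 0 0 (\<nu> w) s"]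
    by (simp add: player_def eval_nat_numeral)
  then have "exec_removals player \<nu> (w # ws) s (6 + 6 * length ws) s'"
    using IH(1) by (rule exec_removals.Cons)
  moreover have "length (w # ws) \<le> card (verts T)"
  proof -
    have "finite (verts T)" using tracks_verts[OF Cons.prems(1)] finite_V finite_subset by blast
    then have "card (verts (delete_vertex T w)) < card (verts T)"
      using Cons.hyps(1) card_Diff1_less[of "verts T" w] by (simp add: delete_vertex_def)
    then show ?thesis using IH(2) by simp
  qed
  ultimately show ?case using IH(3,4,5) by (auto simp: delete_vertex_def intro!: exI[of _ s'] exI[of _ p'])
qed

definition step_cost :: nat where "step_cost = 1500 * Suc nv ^ 4 + 6 * nv"

text \<open>The measure is lexicographic: without removals the number of missing edges drops by one,
  while a batch of removals lowers \<open>r\<close> and leaves at most \<open>d * n\<close> edges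
  missing, less than the weight \<open>Suc (d * n)\<close> of \<open>r\<close>. Each unit of the
  measure has budget \<open>step_cost\<close>.\<close>

lemma wins:
  assumes "tracks p T" "loaded p s" "card (edges T) \<le> d * n"
    and "step_cost * (r * Suc (d * n) + (d * n - card (edges T))) \<le> t"
  shows "wins_from G S (d * n) d \<nu> player T r s t"
  using assms
proof (induction "r * Suc (d * n) + (d * n - card (edges T))" arbitrary: p T r s t rule: less_induct)
  case less
  note T = less.prems(1)
  let ?N = "d * n"
  show ?case
  proof (cases "card (edges T) = ?N")
    case True
    then show ?thesis by (rule wins_from.won)
  next
    case False
    then have lt: "card (edges T) < ?N" using less.prems(3) by simp
    let ?k = "r * Suc ?N + (?N - card (edges T))"
    interpret position nv n d nb "\<nu> ` S" p by (rule tracks_position[OF T lt])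
    show ?thesis
    proof (rule wins_from.step[OF lt])
      fix v assume v: "v \<in> verts T" "deg T v < d"
      have vG: "v \<in> verts G" using v tracks_verts[OF T] by auto
      let ?s = "store ''request'' 0 0 (\<nu> v) s"
      have "loaded p ?s" using less.prems(2) by (simp add: loaded_def)
      then have "runs respond ?s (1500 * Suc nv ^ 4) (\<lambda>s'. \<exists>u. loaded (p(u := Suc (\<nu> v))) s' \<and>
        s' ''answer'' 0 0 = u \<and> u \<in> nb (\<nu> v) \<and> u \<notin> \<nu> ` S \<and> p u = 0 \<and> hall (p(u := Suc (\<nu> v))))"
        using children_le_deg[OF T v(1)] v(2) \<nu>_less[OF vG] by (intro respond_runs) simp_all
      then obtain t1 s' u where e: "exec respond ?s t1 s'" "t1 \<le> 1500 * Suc nv ^ 4"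
        and l: "loaded (p(u := Suc (\<nu> v))) s'" "s' ''answer'' 0 0 = u"
        and u: "u \<in> nb (\<nu> v)" "u \<notin> \<nu> ` S" "p u = 0" "hall (p(u := Suc (\<nu> v)))"
        unfolding runs_def by blast
      let ?T = "add_leaf T v (\<mu> u)"
      have T': "tracks (p(u := Suc (\<nu> v))) ?T" by (rule tracks_add[OF T v u])
      have un: "u < nv" using nb_less[OF u(1)] by simp
      have mem: "\<mu> u \<in> nbrs G v \<inter> (verts G - verts T)"
        using nb_edge[OF u(1)] vG \<mu>_V[OF un] tracks_fresh[OF T un u(2,3)] by (simp add: nbrs_def)
      have cardT: "card (edges ?T) = Suc (card (edges T))"
      proof -
        have "{i. (p(u := Suc (\<nu> v))) i \<noteq> 0} = insert u {i. p i \<noteq> 0}" by auto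
        then show ?thesis
          unfolding tracks_card[OF T'] tracks_card[OF T]
          using card_insert_disjoint[OF tracks_finite[OF T], of u] u(3) by simp
      qed
      have budget: "step_cost * k' \<le> t - (t1 + t2)" "t1 + t2 \<le> t" if "k' < ?k" "t2 \<le> 6 * nv" for k' t2
      proof -
        have "step_cost * Suc k' \<le> step_cost * ?k" using that(1) by (intro mult_left_mono) auto
        then have "step_cost * k' + step_cost \<le> t" using less.prems(4) by simp
        moreover have "t1 + t2 \<le> step_cost" using e(2) that(2) by (simp add: step_cost_def)
        ultimately show "step_cost * k' \<le> t - (t1 + t2)" "t1 + t2 \<le> t" by linarith+
      qed
      have rest: "\<exists>t2 s''. exec_removals player \<nu> ws s' t2 s'' \<and> t1 + t2 \<le> t \<and>
          wins_from G S ?N d \<nu> player T2 (if ws = [] then r else r - 1) s'' (t - (t1 + t2))"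
        if rem: "removals S ?T ws T2" and r: "ws = [] \<or> 0 < r" for ws T2
      proof -
        obtain s'' p' where x: "exec_removals player \<nu> ws s' (6 * length ws) s''"
          "length ws \<le> card (verts ?T)" "tracks p' T2" "loaded p' s''" "edges T2 \<subseteq> edges ?T"
          using tracks_removals[OF rem T' l(1)] by blast
        have "card (verts ?T) \<le> nv"
          unfolding nv_def by (rule card_mono[OF finite_V tracks_verts[OF T']])
        then have t2: "6 * length ws \<le> 6 * nv" using x(2) by simp
        have "finite (edges ?T)"
          using tracksD(5)[OF T'] tracks_finite[OF T'] bij_betw_finite by blast
        then have c: "card (edges T2) \<le> Suc (card (edges T))"
          using card_mono[OF _ x(5)] cardT by simp
        let ?r = "if ws = [] then r else r - 1"
        have k: "?r * Suc ?N + (?N - card (edges T2)) < ?k"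
        proof (cases "ws = []")
          case True
          then have "T2 = ?T" using rem by (auto elim: removals.cases)
          then show ?thesis using True cardT lt by simp
        next
          case False
          then obtain r' where "r = Suc r'" using r by (cases r) auto
          then show ?thesis using False lt by simp
        qed
        have "wins_from G S ?N d \<nu> player T2 ?r s'' (t - (t1 + 6 * length ws))"
          by (rule less.hyps[OF k x(3,4) _ budget(1)[OF k t2]]) (use c lt in simp)
        then show ?thesis using x(1) budget(2)[OF k t2] by blast
      qed
      have "t1 \<le> t" using budget(2)[of 0 0] lt by simp
      then show "\<exists>t1 s' u. exec (on_request player) (store ''request'' 0 0 (\<nu> v) s) t1 s' \<and> t1 \<le> t \<and>
         u \<in> nbrs G v \<inter> (verts G - verts T) \<and> s' ''answer'' 0 0 = \<nu> u \<and>
         (card (edges (add_leaf T v u)) = ?N \<or>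
          (\<forall>ws T'. removals S (add_leaf T v u) ws T' \<longrightarrow> (ws = [] \<or> 0 < r) \<longrightarrow>
            (\<exists>t2 s''. exec_removals player \<nu> ws s' t2 s'' \<and> t1 + t2 \<le> t \<and>
               wins_from G S ?N d \<nu> player T' (if ws = [] then r else r - 1) s'' (t - (t1 + t2)))))"
        using e(1) mem l(2) un rest
        by (intro exI[of _ t1] exI[of _ s'] exI[of _ "\<mu> u"]) (simp add: player_def)
    qed
  qed
qed

lemma loaded_input: "loaded (\<lambda>_. 0) (input G S N m d \<nu>)"
  unfolding loaded_def by (auto simp: input_def nb_def nv_def)

text \<open>The initial measure is at most the square of 1 + m + nv because
  \<open>d * n \<le> nv\<close>, and a step costs at most 1506 times its fourth power.\<close>

lemma wins_in_time:
  "wins_game player G S (d * n) m d \<nu> (1507 * Suc (m + nv) ^ 6)"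
proof -
  let ?K = "m + nv"
  have N: "d * n \<le> nv" by (rule size_bound[OF nv_pos])
  have "step_cost \<le> 1500 * Suc ?K ^ 4 + 6 * Suc ?K ^ 4"
    unfolding step_cost_def
    by (intro add_mono mult_le_mono power_mono le_trans[OF _ self_le_power]) auto
  then have c: "step_cost \<le> 1506 * Suc ?K ^ 4" by simp
  have "m * Suc (d * n) + d * n \<le> Suc m * Suc (d * n)" by simp
  also have "\<dots> \<le> Suc ?K ^ 2" unfolding power2_eq_square using N by (intro mult_le_mono) auto
  finally have "step_cost * (m * Suc (d * n) + (d * n - card (edges (S, {})))) \<le>
      1506 * Suc ?K ^ 4 * Suc ?K ^ 2"
    using c by (intro mult_le_mono) auto
  also have "\<dots> = 1506 * Suc ?K ^ 6" by (simp flip: power_add)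
  \<comment> \<open>One operation is set aside for the \<open>Skip\<close> at the start.\<close>
  also have "\<dots> \<le> 1507 * Suc ?K ^ 6 - 1" using one_le_power[of "Suc ?K" 6] by linarith
  finally have "wins_from G S (d * n) d \<nu> player (S, {}) m (input G S (d * n) m d \<nu>)
      (1507 * Suc ?K ^ 6 - 1)"
    by (intro wins[OF tracks_init loaded_input]) simp_all
  moreover have "exec (on_start player) (input G S (d * n) m d \<nu>) 1 (input G S (d * n) m d \<nu>)"
    using exec.Skip by (simp add: player_def)
  ultimately show ?thesis unfolding wins_game_def by fastforce
qed

end

theorem theorem2p8:
  "\<exists>(A :: algorithm) (p :: nat poly).
     \<forall>(\<alpha> :: real) (\<beta> :: real) (n :: nat) (d :: nat) (m :: nat)
       (G :: 'a graph) (S :: 'a set) (\<nu> :: 'a \<Rightarrow> nat).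
       0 < \<alpha> \<longrightarrow> 0 < \<beta> \<longrightarrow> \<beta> < 2 * \<alpha> - 1 \<longrightarrow>
       simple_graph G \<longrightarrow> property_P \<alpha> n d G \<longrightarrow>
       S \<subseteq> verts G \<longrightarrow> S \<noteq> {} \<longrightarrow>
       (\<forall>x\<in>verts G. real (card (nbrs G x \<inter> S)) \<le> \<beta> * real (deg G x)) \<longrightarrow>
       bij_betw \<nu> (verts G) {..<card (verts G)} \<longrightarrow>
       wins_game A G S (d * n) m d \<nu> (poly p (m + card (verts G)))"
proof (intro exI allI impI)
  fix \<alpha> \<beta> :: real and n d m :: nat and G :: "'a graph" and S :: "'a set" and \<nu> :: "'a \<Rightarrow> nat"
  assume *: "\<beta> < 2 * \<alpha> - 1" "simple_graph G" "property_P \<alpha> n d G" "S \<subseteq> verts G" "S \<noteq> {}"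
    "\<forall>x\<in>verts G. real (card (nbrs G x \<inter> S)) \<le> \<beta> * real (deg G x)"
    "bij_betw \<nu> (verts G) {..<card (verts G)}"
  let ?p = "smult 1507 ([:1, 1:] ^ 6) :: nat poly"
  have p: "poly ?p k = 1507 * Suc k ^ 6" for k by simp
  show "wins_game player G S (d * n) m d \<nu> (poly ?p (m + card (verts G)))"
  proof (cases "d * n = 0")
    case True
    \<comment> \<open>The initial forest already has \<open>d * n = 0\<close> edges, so the game is
      won before any request.\<close>
    have "exec (on_start player) (input G S (d * n) m d \<nu>) 1 (input G S (d * n) m d \<nu>)"
      using exec.Skip by (simp add: player_def)
    moreover have "wins_from G S (d * n) d \<nu> player (S, {}) m s t" for s t
      by (rule wins_from.won) (use True in simp)
    moreover have "1 \<le> poly ?p (m + card (verts G))" unfolding p by simp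
    ultimately show ?thesis unfolding wins_game_def by blast
  next
    case False
    then interpret game \<alpha> \<beta> n d G S \<nu> using * by unfold_locales auto
    show ?thesis using wins_in_time[of m] unfolding p nv_def .
  qed
qed

end
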